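(* Under a generalized $\beta$-conformal change $\overline L=f(e^{\sigma}L,\beta)$ of a Finsler space $(M,L)$, the T-tensor of $(M,\overline L)$ is $$\begin{aligned}\overline T_{lijk}=\;&\frac{e^{\sigma}p\overline L}{L}T_{lijk}-\overline L\left(\frac{\beta e^{\sigma}p_{-1}}{2L^2}+2K_3\right)(h_{li}h_{jk}+h_{lj}h_{ik}+h_{lk}h_{ij})\\ &+(h_{li}\nu_{jk}+h_{lj}\nu_{ik}+h_{ij}\nu_{lk}+h_{jk}\nu_{il}+h_{lk}\nu_{ij}+h_{ik}\nu_{jl})\\ &+\left(e^{\sigma}pf_2-\tfrac12e^{\sigma}\overline Lp_{-1}\right)(C_{lij}m_k+C_{ijk}m_l+C_{jlk}m_i+C_{lik}m_j)\\ &-\overline L(M_{ij}C_{lk\beta}+M_{jl}C_{ik\beta}+M_{il}C_{jk\beta}+M_{lk}C_{ij\beta}+M_{jk}C_{il\beta}+M_{ik}C_{jl\beta})\\ &+\overline Le^{2\sigma}s_0p^2(C_{ij\beta}C_{lk\beta}+C_{lj\beta}C_{ik\beta}+C_{il\beta}C_{jk\beta})+\tfrac12\overline L(6K_5+p_{022})m_lm_im_jm_k\\ &-\frac{\overline Lp_{02}}{2L}(n_{ij}m_km_l+n_{lk}m_im_j)+\tfrac12p_{02}(\dot n_{ij}m_km_l+\dot n_{lk}m_im_j),\end{aligned}$$ where $$\nu_{ij}=\tfrac12e^{\sigma}p_{-1}\dot n_{ij}-\overline L\left(K_1+\frac{3e^{\sigma}p_{-1}^2}{4p}+\frac{\beta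 p_{02}}{2L^2}\right)m_im_j-\frac{\overline Le^{\sigma}p_{-1}}{2L}n_{ij},$$ $$K_5=e^{2\sigma}s_0p_{-1}^2-\frac{4e^{\sigma}p_{-1}p_{02}+p_{02}^2m^2}{4(e^{\sigma}p+q_0m^2)},$$ $$n_{ij}=l_im_j+l_jm_i,\qquad \dot n_{ij}=\overline l_im_j+\overline l_jm_i,\qquad M_{ij}=K_2h_{ij}+K_4m_im_j.$$
   Context: $(M,L)$ is an $n$-dimensional smooth Finsler manifold; $\dot\partial_i=\partial/\partial y^i$, $g_{ij}=\frac12\dot\partial_i\dot\partial_jL^2$ (indices of unbarred objects are raised with $g^{ij}$), $l_i=\dot\partial_iL$, $y_i=g_{ij}y^j$, $h_{ij}=g_{ij}-l_il_j$, $C_{ijk}=\frac12\dot\partial_kg_{ij}$, $C^i_{jk}=g^{ir}C_{rjk}$. The vertical covariant derivative (Cartan connection) is $C_{hij}|_k=\dot\partial_kC_{hij}-C_{mij}C^m_{hk}-C_{hmj}C^m_{ik}-C_{him}C^m_{jk}$. The T-tensor is $$T_{hijk}=L\,C_{hij}|_k+C_{hij}l_k+C_{hik}l_j+C_{hjk}l_i+C_{ijk}l_h.$$ A generalized $\beta$-conformal change is $L\mapsto\overline{L}=f(\widetilde L,\beta)$ with $\widetilde L=e^{\sigma(x)}L$, $\sigma$ a smooth function on $M$, $\beta=b_i(x)y^i$ a 1-form, and $f$ smooth and positively homogeneous of degree one in $(\widetilde L,\beta)$; it is assumed that $(M,\overline L)$ is a Finsler space. Barred objects are those of $(M,\overline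 L)$ (e.g. $\overline l_i=\dot\partial_i\overline L$). Subscripts $1,2$ on $f$ denote partial derivatives with respect to $\widetilde L,\beta$. Put $p=ff_1/L$, $q_0=ff_{22}$, $p_0=f_2^2+q_0$, $p_{-1}=ff_{12}/L+pf_2/f$, $p_{02}=\partial p_0/\partial\beta$, $p_{022}=\partial p_{02}/\partial\beta$, $m_i=b_i-(\beta/L^2)y_i$, $m^2=g^{ij}m_im_j$, $b^i=g^{ij}b_j$, $C_{ij\beta}=C_{ijr}b^r$, $$s_0=\frac{e^{-\sigma}q_0}{p(e^{\sigma}p+m^2q_0)},\qquad K_1=\frac{e^{2\sigma}p_{-1}^2}{4p}(e^{-\sigma}-2s_0pm^2)+\frac{e^{\sigma}p_{-1}p_{02}m^2}{4(e^{\sigma}p+q_0m^2)},$$ $$K_2=\frac{e^{\sigma}p_{-1}}{2}-\frac12e^{2\sigma}s_0p\,p_{-1}m^2,\quad K_3=\frac{e^{2\sigma}p_{-1}^2m^2}{8(e^{\sigma}p+q_0m^2)},\quad K_4=\frac{e^{\sigma}p\,p_{02}}{2(e^{\sigma}p+q_0m^2)}-e^{2\sigma}s_0p\,p_{-1}.$$ Standing assumptions at the points under consideration: $m_i\ne0$, $m^2\neq0$, $p\ne0$, $e^{\sigma}p+m^2q_0\neq0$. *)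

theory Defs
  imports "HOL-Analysis.Analysis"
begin

(* S is meant to be open. *)
primrec Ck_on :: "nat \<Rightarrow> 'v::real_normed_vector set \<Rightarrow> ('v \<Rightarrow> 'w::real_normed_vector) \<Rightarrow> bool" where
  "Ck_on 0 S f \<longleftrightarrow> continuous_on S f"
| "Ck_on (Suc k) S f \<longleftrightarrow>
     (\<forall>x\<in>S. f differentiable (at x)) \<and> (\<forall>v. Ck_on k S (\<lambda>x. frechet_derivative f (at x) v))"

definition smooth_on :: "'v::real_normed_vector set \<Rightarrow> ('v \<Rightarrow> 'w::real_normed_vector) \<Rightarrow> bool" where
  "smooth_on S f \<longleftrightarrow> (\<forall>k. Ck_on k S f)"

(* A chart is a pair of its domain and its coordinate map; the map is irrelevant off the domain. *)
type_synonym ('a, 'n) chart = "'a set \<times> ('a \<Rightarrow> real ^ 'n)"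

definition chart_image :: "('a, 'n::finite) chart \<Rightarrow> (real ^ 'n) set" where
  "chart_image c = snd c ` fst c"

definition chart_inv :: "('a, 'n::finite) chart \<Rightarrow> real ^ 'n \<Rightarrow> 'a" where
  "chart_inv c = inv_into (fst c) (snd c)"

definition transition :: "('a, 'n::finite) chart \<Rightarrow> ('a, 'n) chart \<Rightarrow> real ^ 'n \<Rightarrow> real ^ 'n" where
  "transition c d = snd d \<circ> chart_inv c"

(* The atlas need not be maximal. *)
definition smooth_manifold :: "'a topology \<Rightarrow> ('a, 'n::finite) chart set \<Rightarrow> bool" where
  "smooth_manifold X A \<longleftrightarrow>
     Hausdorff_space X \<and> second_countable X \<and>
     (\<Union>c\<in>A. fst c) = topspace X \<and>
     (\<forall>c\<in>A. openin X (fst c) \<and> open (chart_image c) \<and>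
        homeomorphic_map (subtopology X (fst c)) (top_of_set (chart_image c)) (snd c)) \<and>
     (\<forall>c\<in>A. \<forall>d\<in>A. smooth_on (snd c ` (fst c \<inter> fst d)) (transition c d))"

(* A tangent vector at p is the family of its coordinate vectors in the charts around p, subject
   to the transformation law v_d = D(d o c^{-1}) v_c, and is 0 at the pairs that are not charts
   around p.  A function F on the tangent bundle has type 'a => ('a,'n) tvec => real; only its
   values at (p, v) with v tangent at p matter. *)
type_synonym ('a, 'n) tvec = "('a, 'n) chart \<Rightarrow> real ^ 'n"

(* The tangent vector at p whose coordinate vector in the chart c is y. *)
definition coord_vec :: "('a, 'n::finite) chart set \<Rightarrow> ('a, 'n) chart \<Rightarrow> 'a \<Rightarrow> real ^ 'n \<Rightarrow> ('a, 'n) tvec" where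
  "coord_vec A c p y =
     (\<lambda>d. if d \<in> A \<and> p \<in> fst d then frechet_derivative (transition c d) (at (snd c p)) y else 0)"

(* F in the induced coordinates (x, y) of the tangent bundle. *)
definition local_rep :: "('a, 'n::finite) chart set \<Rightarrow> ('a, 'n) chart \<Rightarrow>
    ('a \<Rightarrow> ('a, 'n) tvec \<Rightarrow> real) \<Rightarrow> real ^ 'n \<Rightarrow> real ^ 'n \<Rightarrow> real" where
  "local_rep A c F x y = F (chart_inv c x) (coord_vec A c (chart_inv c x) y)"

definition smooth_function :: "('a, 'n::finite) chart set \<Rightarrow> ('a \<Rightarrow> real) \<Rightarrow> bool" where
  "smooth_function A s \<longleftrightarrow> (\<forall>c\<in>A. smooth_on (chart_image c) (s \<circ> chart_inv c))"

definition one_form :: "('a, 'n::finite) chart set \<Rightarrow> ('a \<Rightarrow> ('a, 'n) tvec \<Rightarrow> real) \<Rightarrow> bool" where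
  "one_form A B \<longleftrightarrow> (\<forall>c\<in>A.
     (\<forall>x\<in>chart_image c. linear (local_rep A c B x)) \<and>
     (\<forall>i. smooth_on (chart_image c) (\<lambda>x. local_rep A c B x (axis i 1))))"

(* The following operators act on functions of the fibre coordinate y only. *)

(* partial derivative with respect to y^i *)
definition dot_deriv :: "'n::finite \<Rightarrow> (real ^ 'n \<Rightarrow> real) \<Rightarrow> real ^ 'n \<Rightarrow> real" where
  "dot_deriv i F y = deriv (\<lambda>t. F (y + t *\<^sub>R axis i 1)) 0"

definition supp_form :: "(real ^ 'n \<Rightarrow> real) \<Rightarrow> real ^ 'n \<Rightarrow> 'n::finite \<Rightarrow> real" where
  "supp_form F y i = dot_deriv i F y"

definition fund_tensor :: "(real ^ 'n \<Rightarrow> real) \<Rightarrow> real ^ 'n \<Rightarrow> 'n::finite \<Rightarrow> 'n \<Rightarrow> real" where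
  "fund_tensor F y i j = 1 / 2 * dot_deriv i (dot_deriv j (\<lambda>z. (F z)\<^sup>2)) y"

(* g^{ij} *)
definition fund_inv :: "(real ^ 'n \<Rightarrow> real) \<Rightarrow> real ^ 'n \<Rightarrow> 'n::finite \<Rightarrow> 'n \<Rightarrow> real" where
  "fund_inv F y i j = matrix_inv (\<chi> i j. fund_tensor F y i j) $ i $ j"

definition ang_metric :: "(real ^ 'n \<Rightarrow> real) \<Rightarrow> real ^ 'n \<Rightarrow> 'n::finite \<Rightarrow> 'n \<Rightarrow> real" where
  "ang_metric F y i j = fund_tensor F y i j - supp_form F y i * supp_form F y j"

definition cartan :: "(real ^ 'n \<Rightarrow> real) \<Rightarrow> real ^ 'n \<Rightarrow> 'n::finite \<Rightarrow> 'n \<Rightarrow> 'n \<Rightarrow> real" where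
  "cartan F y i j k = 1 / 2 * dot_deriv k (\<lambda>z. fund_tensor F z i j) y"

(* C^i_{jk} *)
definition cartan_up :: "(real ^ 'n \<Rightarrow> real) \<Rightarrow> real ^ 'n \<Rightarrow> 'n::finite \<Rightarrow> 'n \<Rightarrow> 'n \<Rightarrow> real" where
  "cartan_up F y i j k = (\<Sum>r\<in>UNIV. fund_inv F y i r * cartan F y r j k)"

(* C_{hij}|_k *)
definition cartan_vcov :: "(real ^ 'n \<Rightarrow> real) \<Rightarrow> real ^ 'n \<Rightarrow> 'n::finite \<Rightarrow> 'n \<Rightarrow> 'n \<Rightarrow> 'n \<Rightarrow> real" where
  "cartan_vcov F y h i j k =
     dot_deriv k (\<lambda>z. cartan F z h i j) y
     - (\<Sum>m\<in>UNIV. cartan F y m i j * cartan_up F y m h k)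
     - (\<Sum>m\<in>UNIV. cartan F y h m j * cartan_up F y m i k)
     - (\<Sum>m\<in>UNIV. cartan F y h i m * cartan_up F y m j k)"

definition T_tensor :: "(real ^ 'n \<Rightarrow> real) \<Rightarrow> real ^ 'n \<Rightarrow> 'n::finite \<Rightarrow> 'n \<Rightarrow> 'n \<Rightarrow> 'n \<Rightarrow> real" where
  "T_tensor F y h i j k =
     F y * cartan_vcov F y h i j k
     + cartan F y h i j * supp_form F y k + cartan F y h i k * supp_form F y j
     + cartan F y h j k * supp_form F y i + cartan F y i j k * supp_form F y h"

(* L is defined on the slit tangent bundle; its values on zero vectors are not used.  As L > 0
   on all nonzero vectors, nondegeneracy of the metric is the same as positive definiteness:
   at a point of the indicatrix of maximal Euclidean norm the metric is positive definite, and
   its signature is constant along the fibre (and the two directions of a line fibre are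
   trivial). *)
definition finsler_space :: "('a, 'n::finite) chart set \<Rightarrow> ('a \<Rightarrow> ('a, 'n) tvec \<Rightarrow> real) \<Rightarrow> bool" where
  "finsler_space A L \<longleftrightarrow> (\<forall>c\<in>A.
     smooth_on (chart_image c \<times> (UNIV - {0})) (\<lambda>(x, y). local_rep A c L x y) \<and>
     (\<forall>x\<in>chart_image c. \<forall>y. y \<noteq> 0 \<longrightarrow>
        local_rep A c L x y > 0 \<and>
        (\<forall>t>0. local_rep A c L x (t *\<^sub>R y) = t * local_rep A c L x y) \<and>
        invertible (\<chi> i j. fund_tensor (local_rep A c L x) y i j)))"

(* partial derivatives of a function of two real variables *)
definition partial1 :: "(real \<Rightarrow> real \<Rightarrow> real) \<Rightarrow> real \<Rightarrow> real \<Rightarrow> real" where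
  "partial1 f u v = deriv (\<lambda>s. f s v) u"

definition partial2 :: "(real \<Rightarrow> real \<Rightarrow> real) \<Rightarrow> real \<Rightarrow> real \<Rightarrow> real" where
  "partial2 f u v = deriv (\<lambda>s. f u s) v"

(* D is an open cone in the (L~, beta)-plane on which f is defined; f need not extend smoothly to
   the whole plane (it does not for Kropina or Matsumoto type f, for instance). *)
definition homogeneous_function :: "(real \<times> real) set \<Rightarrow> (real \<Rightarrow> real \<Rightarrow> real) \<Rightarrow> bool" where
  "homogeneous_function D f \<longleftrightarrow>
     open D \<and> smooth_on D (\<lambda>(u, v). f u v) \<and>
     (\<forall>u v t. (u, v) \<in> D \<and> t > 0 \<longrightarrow> (t * u, t * v) \<in> D \<and> f (t * u) (t * v) = t * f u v)"

definition gen_beta_change :: "(real \<Rightarrow> real \<Rightarrow> real) \<Rightarrow> ('a \<Rightarrow> real) \<Rightarrow>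
    ('a \<Rightarrow> ('a, 'n::finite) tvec \<Rightarrow> real) \<Rightarrow> ('a \<Rightarrow> ('a, 'n) tvec \<Rightarrow> real) \<Rightarrow> ('a \<Rightarrow> ('a, 'n) tvec \<Rightarrow> real)" where
  "gen_beta_change f \<sigma> \<beta> L = (\<lambda>p v. f (exp (\<sigma> p) * L p v) (\<beta> p v))"

end

theory Submission
  imports Defs
begin

text \<open>Over a fixed point of a chart the statement lives in one fibre: \<open>L\<close> and \<open>Lbar\<close> restrict to
Minkowski norms \<open>F\<close> and \<open>Fb\<close> with \<open>Fb z = f (e\<^sup>\<sigma> F z) (\<beta> z)\<close>, where \<open>\<beta>\<close> is linear.
There everything follows from a short list of vertical derivatives (\<open>d\<^sub>k\<close> is the partial
derivative in \<open>y\<^sup>k\<close>):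
\<open>d\<^sub>k F = l\<^sub>k\<close>, \<open>d\<^sub>k l\<^sub>i = h\<^sub>i\<^sub>k / F\<close>,
\<open>d\<^sub>k h\<^sub>i\<^sub>j = 2 C\<^sub>i\<^sub>j\<^sub>k - (h\<^sub>i\<^sub>k l\<^sub>j + h\<^sub>j\<^sub>k l\<^sub>i) / F\<close>,
\<open>d\<^sub>k m\<^sub>i = - \<beta>/F\<^sup>2 h\<^sub>i\<^sub>k - m\<^sub>k l\<^sub>i / F\<close>, and \<open>d\<^sub>k \<phi> = \<phi>\<^sub>2 m\<^sub>k + r \<phi> l\<^sub>k / F\<close> for a function \<open>\<phi>\<close> of
\<open>(e\<^sup>\<sigma> F, \<beta>)\<close> that is homogeneous of degree \<open>r\<close>. In the last rule (\<open>deriv_pull\<close>) Euler's relation has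
eliminated the derivative in the first argument, so that only \<open>\<beta>\<close>-derivatives of \<open>f\<close> ever occur;
Euler's relation passes to them by the symmetry of second derivatives.

Write \<open>A = e\<^sup>\<sigma> p\<close>, \<open>2 B = e\<^sup>\<sigma> p\<^sub>-\<^sub>1\<close>, \<open>2 D = p\<^sub>0\<^sub>2\<close>, \<open>2 E = p\<^sub>0\<^sub>2\<^sub>2\<close>. The rules
\<open>d\<^sub>k l\<^sub>i = h\<^sub>i\<^sub>k / F\<close> and the one for \<open>d\<^sub>k h\<^sub>i\<^sub>j\<close> hold for \<open>Fb\<close> as well. Read backwards, they give the
barred angular metric \<open>A h\<^sub>i\<^sub>j + q\<^sub>0 m\<^sub>i m\<^sub>j\<close> (\<open>ang_metric_Fb\<close>) and the barred Cartan tensor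
\<open>A C\<^sub>i\<^sub>j\<^sub>k + B (h\<^sub>i\<^sub>j m\<^sub>k + h\<^sub>i\<^sub>k m\<^sub>j + h\<^sub>j\<^sub>k m\<^sub>i) + D m\<^sub>i m\<^sub>j m\<^sub>k\<close> (\<open>cartan_Fb\<close>). The derivatives of the
coefficients are again of this kind: \<open>d\<^sub>k A = 2 B m\<^sub>k\<close>, \<open>d\<^sub>k B = - \<beta> D/F\<^sup>2 m\<^sub>k - B l\<^sub>k/F\<close>, \<open>d\<^sub>k D = E m\<^sub>k - D l\<^sub>k/F\<close>. Hence one more
differentiation yields the linear part of the barred vertical covariant derivative.

The quadratic part contracts two barred Cartan tensors with the inverse of the barred metric. Cartan
tensors annihilate \<open>y\<close>, and on covectors that annihilate \<open>y\<close> this inverse is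
\<open>g\<^sup>-\<^sup>1 / A - s\<^sub>0 m m\<close> up to a multiple of \<open>y\<close>, which the contraction does not see (\<open>raise_Fb\<close>, \<open>ip_Fb\<close>).
All contractions thereby reduce to \<open>C C\<close>, \<open>C\<^sub>i\<^sub>j\<^sub>\<beta>\<close> and \<open>m\<^sup>2\<close>. What is left is a polynomial
identity (\<open>T_tensor_algebra\<close>), in which \<open>K\<^sub>1, \<dots>, K\<^sub>5\<close> collect the coefficients that the three
contractions produce.\<close>

section \<open>Directional derivatives of smooth functions\<close>

definition dir_deriv :: "'v::real_normed_vector \<Rightarrow> ('v \<Rightarrow> 'w::real_normed_vector) \<Rightarrow> 'v \<Rightarrow> 'w" where
  "dir_deriv v f x = frechet_derivative f (at x) v"

text \<open>A derivative at a point depends on the function near that point; on an open set, equality on the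
set therefore passes to all directional derivatives.\<close>

lemma Ck_on_cong:
  assumes "open S" "\<And>x. x \<in> S \<Longrightarrow> f x = g x" "Ck_on k S f"
  shows "Ck_on k S g"
  using assms(2,3)
proof (induction k arbitrary: f g)
  case 0
  then show ?case by (simp cong: continuous_on_cong)
next
  case (Suc k)
  have d: "f differentiable (at x)" if "x \<in> S" for x
    using Suc.prems that by simp
  have eq: "frechet_derivative f (at x) v = frechet_derivative g (at x) v" if "x \<in> S" for x v
    using frechet_derivative_transform_within_open[OF d assms(1)] that Suc.prems(1) by auto
  have "g differentiable (at x)" if "x \<in> S" for x
    using d[OF that] has_derivative_transform_within_open[OF _ assms(1) that] Suc.prems(1)
    unfolding differentiable_def by blast
  moreover have "Ck_on k S (\<lambda>x. frechet_derivative g (at x) v)" for v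
    using Suc.IH[of "\<lambda>x. frechet_derivative f (at x) v" "\<lambda>x. frechet_derivative g (at x) v"]
      eq Suc.prems(2) by simp
  ultimately show ?case by simp
qed

lemma smooth_on_cong:
  assumes "open S" "\<And>x. x \<in> S \<Longrightarrow> f x = g x" "smooth_on S f"
  shows "smooth_on S g"
  using assms Ck_on_cong unfolding smooth_on_def by blast

lemma smooth_on_continuous_on: "smooth_on S f \<Longrightarrow> continuous_on S f"
  unfolding smooth_on_def using Ck_on.simps(1) by blast

lemma smooth_on_differentiable: "smooth_on S f \<Longrightarrow> x \<in> S \<Longrightarrow> f differentiable (at x)"
  unfolding smooth_on_def using Ck_on.simps(2) by blast

lemma smooth_on_dir_deriv: "smooth_on S f \<Longrightarrow> smooth_on S (dir_deriv v f)"
  unfolding smooth_on_def dir_deriv_def[abs_def] using Ck_on.simps(2) by blast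

lemma smooth_on_has_derivative:
  "smooth_on S f \<Longrightarrow> x \<in> S \<Longrightarrow> (f has_derivative (\<lambda>v. dir_deriv v f x)) (at x)"
  unfolding dir_deriv_def using smooth_on_differentiable frechet_derivative_works by blast

lemma dir_deriv_cong:
  assumes "open S" "\<And>x. x \<in> S \<Longrightarrow> f x = g x" "smooth_on S f" "x \<in> S"
  shows "dir_deriv v f x = dir_deriv v g x"
  unfolding dir_deriv_def
  using frechet_derivative_transform_within_open[OF smooth_on_differentiable[OF assms(3,4)] assms(1,4)]
    assms(2) by auto

lemma DERIV_along_line:
  fixes f :: "'v::real_normed_vector \<Rightarrow> real"
  assumes "smooth_on S f" "x + t *\<^sub>R v \<in> S"
  shows "((\<lambda>t. f (x + t *\<^sub>R v)) has_real_derivative dir_deriv v f (x + t *\<^sub>R v)) (at t)"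
proof -
  let ?x = "x + t *\<^sub>R v"
  have f: "(f has_derivative (\<lambda>w. dir_deriv w f ?x)) (at ?x)"
    using smooth_on_has_derivative[OF assms] .
  have "((\<lambda>t. x + t *\<^sub>R v) has_derivative (\<lambda>t. t *\<^sub>R v)) (at t)"
    by (auto intro!: derivative_eq_intros)
  from has_derivative_compose[OF this f]
  have "((\<lambda>t. f (x + t *\<^sub>R v)) has_derivative (\<lambda>s. dir_deriv (s *\<^sub>R v) f ?x)) (at t)" .
  moreover have "dir_deriv (s *\<^sub>R v) f ?x = dir_deriv v f ?x * s" for s
    using linear_scale[OF has_derivative_linear[OF f]] by simp
  ultimately show ?thesis
    by (simp add: has_field_derivative_def)
qed

lemma has_real_derivative_near:
  fixes z v :: "'v::real_normed_vector"
  assumes "open S" "z \<in> S" "\<And>w. w \<in> S \<Longrightarrow> H w = G w"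
    "((\<lambda>t. H (z + t *\<^sub>R v)) has_real_derivative D) (at 0)"
  shows "((\<lambda>t. G (z + t *\<^sub>R v)) has_real_derivative D) (at 0)"
proof (rule has_field_derivative_transform_within_open[OF assms(4)])
  show "open ((\<lambda>t. z + t *\<^sub>R v) -` S)"
    by (rule open_vimage[OF assms(1)]) (intro continuous_intros)
qed (use assms(2,3) in auto)

text \<open>The mean value theorem, first for \<open>\<tau> \<mapsto> f (x + s w + \<tau> v) - f (x + \<tau> v)\<close> and then for the
resulting difference of derivatives. The left-hand side is symmetric in \<open>v\<close> and \<open>w\<close>, the right-hand
side tells the two orders of differentiation apart.\<close>

lemma second_difference_mean_value:
  fixes f :: "'v::real_normed_vector \<Rightarrow> real"
  assumes f: "smooth_on S f" and s: "0 < s"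
    and sub: "\<And>a b. 0 \<le> a \<Longrightarrow> a \<le> s \<Longrightarrow> 0 \<le> b \<Longrightarrow> b \<le> s \<Longrightarrow> x + a *\<^sub>R v + b *\<^sub>R w \<in> S"
  obtains a b where "0 < a" "a < s" "0 < b" "b < s"
    "f (x + s *\<^sub>R v + s *\<^sub>R w) - f (x + s *\<^sub>R v) - f (x + s *\<^sub>R w) + f x
      = s\<^sup>2 * dir_deriv w (dir_deriv v f) (x + a *\<^sub>R v + b *\<^sub>R w)"
proof -
  define \<phi> where "\<phi> a = f (x + s *\<^sub>R w + a *\<^sub>R v) - f (x + a *\<^sub>R v)" for a
  have "(\<phi> has_real_derivative
      dir_deriv v f (x + s *\<^sub>R w + a *\<^sub>R v) - dir_deriv v f (x + a *\<^sub>R v)) (at a)"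
    if "0 \<le> a" "a \<le> s" for a
    unfolding \<phi>_def
    using that sub[of a s] sub[of a 0] s
    by (intro DERIV_diff DERIV_along_line[OF f]) (auto simp: algebra_simps)
  from MVT2[OF s this] obtain a where a: "0 < a" "a < s" and
    1: "\<phi> s - \<phi> 0 = s * (dir_deriv v f (x + s *\<^sub>R w + a *\<^sub>R v) - dir_deriv v f (x + a *\<^sub>R v))"
    by auto
  define \<psi> where "\<psi> b = dir_deriv v f (x + a *\<^sub>R v + b *\<^sub>R w)" for b
  have "(\<psi> has_real_derivative dir_deriv w (dir_deriv v f) (x + a *\<^sub>R v + b *\<^sub>R w)) (at b)"
    if "0 \<le> b" "b \<le> s" for b
    unfolding \<psi>_def using that sub[of a b] a
    by (intro DERIV_along_line[OF smooth_on_dir_deriv[OF f]]) auto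
  from MVT2[OF s this] obtain b where b: "0 < b" "b < s" and
    2: "\<psi> s - \<psi> 0 = s * dir_deriv w (dir_deriv v f) (x + a *\<^sub>R v + b *\<^sub>R w)"
    by auto
  have "\<phi> s - \<phi> 0 = s * (\<psi> s - \<psi> 0)"
    using 1 by (simp add: \<psi>_def algebra_simps)
  with 2 have "\<phi> s - \<phi> 0 = s\<^sup>2 * dir_deriv w (dir_deriv v f) (x + a *\<^sub>R v + b *\<^sub>R w)"
    by (simp add: power2_eq_square)
  with a b that show thesis by (simp add: \<phi>_def algebra_simps)
qed

text \<open>Both mixed derivatives are values of the same symmetric second difference at points within \<open>s\<close> of \<open>x\<close>;
by continuity they cannot be separated as \<open>s\<close> tends to \<open>0\<close>.\<close>

lemma dir_deriv_commute:
  fixes f :: "'v::real_normed_vector \<Rightarrow> real"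
  assumes f: "smooth_on S f" and S: "open S" and x: "x \<in> S"
  shows "dir_deriv w (dir_deriv v f) x = dir_deriv v (dir_deriv w f) x"
proof (rule ccontr)
  let ?P = "dir_deriv w (dir_deriv v f)" and ?Q = "dir_deriv v (dir_deriv w f)"
  assume ne: "?P x \<noteq> ?Q x"
  define e where "e = \<bar>?P x - ?Q x\<bar> / 2"
  have e: "e > 0" using ne by (simp add: e_def)
  have cont: "isCont (dir_deriv a (dir_deriv b f)) x" for a b
    using f S x by (metis continuous_on_eq_continuous_at smooth_on_continuous_on smooth_on_dir_deriv)
  obtain d1 where d1: "d1 > 0" "\<And>z. dist z x < d1 \<Longrightarrow> dist (?P z) (?P x) < e"
    using cont e unfolding continuous_at_eps_delta by meson
  obtain d2 where d2: "d2 > 0" "\<And>z. dist z x < d2 \<Longrightarrow> dist (?Q z) (?Q x) < e"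
    using cont e unfolding continuous_at_eps_delta by meson
  obtain d3 where d3: "d3 > 0" "ball x d3 \<subseteq> S"
    using S x open_contains_ball by blast
  define d where "d = min d1 (min d2 d3)"
  have d: "d > 0" using d1 d2 d3 by (simp add: d_def)
  \<comment> \<open>All points of the parallelogram with sides \<open>s v\<close> and \<open>s w\<close> are closer to \<open>x\<close> than \<open>d\<close>.\<close>
  define s where "s = d / (2 * (norm v + norm w + 1))"
  have pos: "norm v + norm w + 1 > 0" by (smt (verit) norm_ge_zero)
  have s: "s > 0" using d pos by (simp add: s_def)
  have near: "dist (x + a *\<^sub>R v + b *\<^sub>R w) x < d" if "0 \<le> a" "a \<le> s" "0 \<le> b" "b \<le> s" for a b
  proof -
    have "dist (x + a *\<^sub>R v + b *\<^sub>R w) x = norm (a *\<^sub>R v + b *\<^sub>R w)"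
      by (simp add: dist_norm algebra_simps)
    also have "\<dots> \<le> a * norm v + b * norm w"
      using that norm_triangle_ineq[of "a *\<^sub>R v" "b *\<^sub>R w"] by simp
    also have "\<dots> \<le> s * norm v + s * norm w"
      using that by (intro add_mono mult_right_mono) auto
    also have "\<dots> \<le> s * (norm v + norm w + 1)"
      using s by (simp add: algebra_simps)
    also have "\<dots> = d / 2" using pos unfolding s_def by (simp only: times_divide_eq_left) (simp add: field_simps)
    also have "\<dots> < d" using d by simp
    finally show ?thesis .
  qed
  have inS: "x + a *\<^sub>R v + b *\<^sub>R w \<in> S" if "0 \<le> a" "a \<le> s" "0 \<le> b" "b \<le> s" for a b
    using near[OF that] d3 by (auto simp: d_def dist_commute)
  obtain a b where ab: "0 < a" "a < s" "0 < b" "b < s"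
    "f (x + s *\<^sub>R v + s *\<^sub>R w) - f (x + s *\<^sub>R v) - f (x + s *\<^sub>R w) + f x
      = s\<^sup>2 * ?P (x + a *\<^sub>R v + b *\<^sub>R w)"
    using second_difference_mean_value[OF f s inS] by blast
  have inS': "x + a *\<^sub>R w + b *\<^sub>R v \<in> S" if "0 \<le> a" "a \<le> s" "0 \<le> b" "b \<le> s" for a b
    using inS[of b a] that by (simp add: algebra_simps)
  obtain a' b' where ab': "0 < a'" "a' < s" "0 < b'" "b' < s"
    "f (x + s *\<^sub>R w + s *\<^sub>R v) - f (x + s *\<^sub>R w) - f (x + s *\<^sub>R v) + f x
      = s\<^sup>2 * ?Q (x + a' *\<^sub>R w + b' *\<^sub>R v)"
    using second_difference_mean_value[OF f s inS'] by blast
  have "s\<^sup>2 * ?P (x + a *\<^sub>R v + b *\<^sub>R w) = s\<^sup>2 * ?Q (x + a' *\<^sub>R w + b' *\<^sub>R v)"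
    using ab(5) ab'(5) by (simp add: algebra_simps)
  then have eq: "?P (x + a *\<^sub>R v + b *\<^sub>R w) = ?Q (x + b' *\<^sub>R v + a' *\<^sub>R w)"
    using s by (simp add: add.assoc add.commute[of "a' *\<^sub>R w"])
  have "dist (?P (x + a *\<^sub>R v + b *\<^sub>R w)) (?P x) < e"
    using near[of a b] ab by (intro d1) (auto simp: d_def)
  moreover have "dist (?Q (x + b' *\<^sub>R v + a' *\<^sub>R w)) (?Q x) < e"
    using near[of b' a'] ab' by (intro d2) (auto simp: d_def)
  ultimately have "dist (?P x) (?Q x) < e + e"
    using eq by (metis dist_commute dist_triangle_less_add)
  then show False
    by (simp add: e_def dist_real_def)
qed

text \<open>A derivative of the slice is a derivative of the whole function in a direction \<open>(0, v)\<close>, so the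
induction hypothesis applies to it.\<close>

lemma Ck_on_slice:
  assumes "open V" "x \<in> U" "Ck_on k (U \<times> V) H"
  shows "Ck_on k V (\<lambda>y. H (x, y))"
  using assms(3)
proof (induction k arbitrary: H)
  case 0
  have "continuous_on V (H \<circ> Pair x)"
  proof (rule continuous_on_compose)
    show "continuous_on V (Pair x)" by (intro continuous_intros)
    show "continuous_on (Pair x ` V) H"
      using 0 assms(2) by (auto intro: continuous_on_subset)
  qed
  then show ?case by (simp add: o_def)
next
  case (Suc k)
  have d: "((\<lambda>y. H (x, y)) has_derivative (\<lambda>v. frechet_derivative H (at (x, y)) (0, v))) (at y)"
    if "y \<in> V" for y
  proof (rule has_derivative_compose[of "Pair x"])
    show "(Pair x has_derivative Pair 0) (at y)"
      by (intro has_derivative_Pair has_derivative_const has_derivative_ident)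
    show "(H has_derivative frechet_derivative H (at (x, y))) (at (x, y))"
      using Suc.prems that assms(2) frechet_derivative_works by auto
  qed
  have eq: "frechet_derivative H (at (x, y)) (0, v) = frechet_derivative (\<lambda>y. H (x, y)) (at y) v"
    if "y \<in> V" for y v
    using fun_cong[OF frechet_derivative_at[OF d[OF that]], of v] .
  have slice: "Ck_on k V (\<lambda>y. frechet_derivative H (at (x, y)) (0, v))" for v
    by (rule Suc.IH) (use Suc.prems in simp)
  have "Ck_on k V (\<lambda>y. frechet_derivative (\<lambda>y. H (x, y)) (at y) v)" for v
    using Ck_on_cong[OF assms(1) eq slice] .
  moreover have "(\<lambda>y. H (x, y)) differentiable (at y)" if "y \<in> V" for y
    using d[OF that] unfolding differentiable_def by blast
  ultimately show ?case by simp
qed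

lemma smooth_on_slice:
  "open V \<Longrightarrow> x \<in> U \<Longrightarrow> smooth_on (U \<times> V) H \<Longrightarrow> smooth_on V (\<lambda>y. H (x, y))"
  unfolding smooth_on_def using Ck_on_slice by blast

section \<open>Partial derivatives in the fibre\<close>

text \<open>A relational form of the vertical derivative. The rules of one-variable calculus apply to it
directly and record differentiability together with the value.\<close>

abbreviation has_dot_deriv ::
  "'n::finite \<Rightarrow> (real ^ 'n \<Rightarrow> real) \<Rightarrow> real \<Rightarrow> real ^ 'n \<Rightarrow> bool" where
  "has_dot_deriv i G G' z \<equiv> ((\<lambda>t. G (z + t *\<^sub>R axis i 1)) has_real_derivative G') (at 0)"

lemma dot_deriv_eqI: "has_dot_deriv i G G' z \<Longrightarrow> dot_deriv i G z = G'"
  unfolding dot_deriv_def by (rule DERIV_imp_deriv)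

lemma has_dot_deriv_unique: "has_dot_deriv i G A z \<Longrightarrow> has_dot_deriv i G B z \<Longrightarrow> A = B"
  by (rule DERIV_unique)

lemma has_dot_deriv_cong:
  fixes z :: "real ^ 'n::finite"
  assumes "open S" "z \<in> S" "\<And>w. w \<in> S \<Longrightarrow> H w = G w" "has_dot_deriv i H D z"
  shows "has_dot_deriv i G D z"
  by (rule has_real_derivative_near[OF assms])

lemma has_dot_deriv_dir:
  assumes "smooth_on S G" "z \<in> S"
  shows "has_dot_deriv i G (dir_deriv (axis i 1) G z) z"
  using DERIV_along_line[OF assms(1), of z 0 "axis i 1"] assms(2) by simp

lemma dot_deriv_eq_dir:
  "smooth_on S G \<Longrightarrow> z \<in> S \<Longrightarrow> dot_deriv i G z = dir_deriv (axis i 1) G z"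
  by (rule dot_deriv_eqI) (rule has_dot_deriv_dir)

lemma has_dot_deriv_smooth:
  "smooth_on S G \<Longrightarrow> z \<in> S \<Longrightarrow> has_dot_deriv i G (dot_deriv i G z) z"
  using has_dot_deriv_dir dot_deriv_eq_dir by metis

lemma smooth_on_dot_deriv:
  assumes "open S" "smooth_on S G"
  shows "smooth_on S (dot_deriv i G)"
  using smooth_on_cong[OF assms(1) _ smooth_on_dir_deriv[OF assms(2)]] dot_deriv_eq_dir[OF assms(2)]
  by metis

lemma dot_deriv_commute:
  assumes S: "open S" "smooth_on S G" and z: "z \<in> S"
  shows "dot_deriv i (dot_deriv j G) z = dot_deriv j (dot_deriv i G) z"
proof -
  have "dot_deriv i (dot_deriv j G) z = dir_deriv (axis i 1) (dir_deriv (axis j 1) G) z" for i j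
    by (rule dot_deriv_eqI, rule has_dot_deriv_cong[OF S(1) z, where H = "dir_deriv (axis j 1) G"])
      (auto simp: dot_deriv_eq_dir[OF S(2)] intro: has_dot_deriv_dir smooth_on_dir_deriv S(2) z)
  then show ?thesis
    using dir_deriv_commute[OF S(2,1) z] by metis
qed

lemma has_dot_deriv_coord: "has_dot_deriv k (\<lambda>z. z $ i) (if i = k then 1 else 0) z"
  by (auto simp: axis_def intro!: derivative_eq_intros)

lemma dir_deriv_eq_sum:
  assumes "smooth_on S G" "z \<in> S"
  shows "dir_deriv v G z = (\<Sum>i\<in>UNIV. dot_deriv i G z * v $ i)"
proof -
  have lin: "linear (\<lambda>v. dir_deriv v G z)"
    using smooth_on_has_derivative[OF assms] has_derivative_linear by blast
  have "dir_deriv v G z = dir_deriv (\<Sum>i\<in>UNIV. v $ i *\<^sub>R axis i 1) G z"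
    by (simp add: basis_expansion scalar_mult_eq_scaleR[symmetric])
  also have "\<dots> = (\<Sum>i\<in>UNIV. v $ i * dir_deriv (axis i 1) G z)"
    by (simp add: linear_sum[OF lin] linear_scale[OF lin])
  finally show ?thesis
    by (simp add: dot_deriv_eq_dir[OF assms] mult.commute)
qed

section \<open>Minkowski norms and their fundamental tensors\<close>

text \<open>The restriction of a Finsler function to the punctured tangent space at one point.\<close>

locale minkowski_norm =
  fixes F :: "real ^ 'n::finite \<Rightarrow> real"
  assumes smooth: "smooth_on (UNIV - {0}) F"
    and pos: "z \<noteq> 0 \<Longrightarrow> F z > 0"
    and homogeneous: "z \<noteq> 0 \<Longrightarrow> t > 0 \<Longrightarrow> F (t *\<^sub>R z) = t * F z"
    and nondegenerate: "z \<noteq> 0 \<Longrightarrow> invertible (\<chi> i j. fund_tensor F z i j)"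
begin

abbreviation l where "l z i \<equiv> supp_form F z i"
abbreviation g where "g z i j \<equiv> fund_tensor F z i j"
abbreviation ginv where "ginv z i j \<equiv> fund_inv F z i j"
abbreviation h where "h z i j \<equiv> ang_metric F z i j"
abbreviation C where "C z i j k \<equiv> cartan F z i j k"
abbreviation F2 where "F2 i j \<equiv> dot_deriv i (dot_deriv j F)"
abbreviation F3 where "F3 i j k \<equiv> dot_deriv i (dot_deriv j (dot_deriv k F))"

lemma open_slit: "open (UNIV - {0 :: real ^ 'n})" by (rule open_delete[OF open_UNIV])

lemmas slit_cong = has_dot_deriv_cong[OF open_slit]
lemmas smooth1 = smooth_on_dot_deriv[OF open_slit smooth]
lemmas smooth2 = smooth_on_dot_deriv[OF open_slit smooth1]
lemmas smooth3 = smooth_on_dot_deriv[OF open_slit smooth2]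

lemma F_nonzero: "z \<noteq> 0 \<Longrightarrow> F z \<noteq> 0"
  using pos by (metis less_irrefl)

lemma deriv_F: "z \<noteq> 0 \<Longrightarrow> has_dot_deriv k F (l z k) z"
  unfolding supp_form_def using has_dot_deriv_smooth[OF smooth] by simp

lemma deriv_F1: "z \<noteq> 0 \<Longrightarrow> has_dot_deriv k (dot_deriv i F) (F2 k i z) z"
  using has_dot_deriv_smooth[OF smooth1] by simp

lemma deriv_l: "z \<noteq> 0 \<Longrightarrow> has_dot_deriv k (\<lambda>z. l z i) (F2 k i z) z"
  unfolding supp_form_def by (rule deriv_F1)

lemma deriv_F2: "z \<noteq> 0 \<Longrightarrow> has_dot_deriv k (F2 i j) (F3 k i j z) z"
  using has_dot_deriv_smooth[OF smooth2] by simp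

lemma F2_sym: "z \<noteq> 0 \<Longrightarrow> F2 i j z = F2 j i z"
  using dot_deriv_commute[OF open_slit smooth] by simp

lemma F3_sym:
  assumes "z \<noteq> 0"
  shows "F3 i j k z = F3 j i k z" "F3 i j k z = F3 i k j z"
proof -
  show "F3 i j k z = F3 j i k z"
    using dot_deriv_commute[OF open_slit smooth1] assms by simp
  show "F3 i j k z = F3 i k j z"
    by (rule dot_deriv_eqI, rule slit_cong[where H = "F2 k j"])
      (use assms F2_sym deriv_F2 in auto)
qed

lemma fund_tensor_eq:
  assumes z: "z \<noteq> 0"
  shows "g z i j = l z i * l z j + F z * F2 i j z"
proof -
  have sq: "dot_deriv j (\<lambda>z. (F z)\<^sup>2) w = 2 * F w * l w j" if "w \<noteq> 0" for w
    using DERIV_power[OF deriv_F[OF that, of j], of 2] by (intro dot_deriv_eqI) (simp add: mult_ac)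
  have H: "has_dot_deriv i (\<lambda>w. 2 * F w * l w j) (2 * (l z i * l z j + F z * F2 i j z)) z"
    using DERIV_cmult[OF DERIV_mult[OF deriv_F[OF z, of i] deriv_l[OF z, of i j]], of 2]
    by (simp add: algebra_simps)
  have "has_dot_deriv i (dot_deriv j (\<lambda>z. (F z)\<^sup>2)) (2 * (l z i * l z j + F z * F2 i j z)) z"
    by (rule slit_cong[OF _ _ H]) (use z sq in auto)
  then show ?thesis by (simp add: fund_tensor_def dot_deriv_eqI)
qed

lemma ang_metric_eq: "z \<noteq> 0 \<Longrightarrow> h z i j = F z * F2 i j z"
  by (simp add: ang_metric_def fund_tensor_eq)

lemma ang_metric_sym: "z \<noteq> 0 \<Longrightarrow> h z i j = h z j i"
  by (simp add: ang_metric_eq F2_sym[of z i j])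

lemma fund_tensor_sym: "z \<noteq> 0 \<Longrightarrow> g z i j = g z j i"
  by (simp add: fund_tensor_eq F2_sym[of z i j])

lemma has_dot_deriv_supp_form: "z \<noteq> 0 \<Longrightarrow> has_dot_deriv k (\<lambda>z. l z i) (h z i k / F z) z"
  using deriv_l[of z k i] F_nonzero[of z] by (simp add: ang_metric_eq F2_sym[of z i k])

lemma cartan_eq:
  assumes z: "z \<noteq> 0"
  shows "C z i j k = (F2 k i z * l z j + l z i * F2 k j z + l z k * F2 i j z + F z * F3 k i j z) / 2"
proof -
  have H: "has_dot_deriv k (\<lambda>w. l w i * l w j + F w * F2 i j w)
     (F2 k i z * l z j + l z i * F2 k j z + l z k * F2 i j z + F z * F3 k i j z) z"
    using DERIV_add[OF DERIV_mult[OF deriv_l[OF z, of k i] deriv_l[OF z, of k j]]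
        DERIV_mult[OF deriv_F[OF z, of k] deriv_F2[OF z, of i j k]]]
    by (simp add: algebra_simps)
  have "has_dot_deriv k (\<lambda>w. g w i j)
     (F2 k i z * l z j + l z i * F2 k j z + l z k * F2 i j z + F z * F3 k i j z) z"
    by (rule slit_cong[OF _ _ H]) (use z fund_tensor_eq in auto)
  then show ?thesis by (simp add: cartan_def dot_deriv_eqI)
qed

lemma cartan_sym:
  assumes "z \<noteq> 0"
  shows "C z i j k = C z j i k" "C z i j k = C z i k j"
  using F2_sym[OF assms] F3_sym[OF assms] by (simp_all add: cartan_eq[OF assms])

text \<open>Since \<open>h\<^sub>i\<^sub>j = F d\<^sub>i d\<^sub>j F\<close> and \<open>g\<^sub>i\<^sub>j = h\<^sub>i\<^sub>j + l\<^sub>i l\<^sub>j\<close>, this is the definition of the Cartan tensor solved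
for the derivative of \<open>h\<close>.\<close>

lemma has_dot_deriv_ang_metric:
  assumes z: "z \<noteq> 0"
  shows "has_dot_deriv k (\<lambda>z. h z i j) (2 * C z i j k - (h z i k * l z j + h z j k * l z i) / F z) z"
proof (rule slit_cong[where H = "\<lambda>w. F w * F2 i j w"])
  have "has_dot_deriv k (\<lambda>w. F w * F2 i j w) (l z k * F2 i j z + F z * F3 k i j z) z"
    using DERIV_mult[OF deriv_F[OF z, of k] deriv_F2[OF z, of i j k]]
    by (simp add: algebra_simps)
  then show "has_dot_deriv k (\<lambda>w. F w * F2 i j w)
     (2 * C z i j k - (h z i k * l z j + h z j k * l z i) / F z) z"
    using F_nonzero[OF z] F2_sym[OF z, of k]
    by (simp add: cartan_eq[OF z] ang_metric_eq[OF z] add_divide_distrib)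
qed (use z ang_metric_eq in auto)

lemma has_dot_deriv_cartan:
  assumes z: "z \<noteq> 0"
  shows "has_dot_deriv n (\<lambda>z. C z i j k) (dot_deriv n (\<lambda>z. C z i j k) z) z"
proof -
  define H where "H w = (F2 k i w * l w j + l w i * F2 k j w + l w k * F2 i j w + F w * F3 k i j w) / 2" for w
  have F3: "has_dot_deriv n (F3 k i j) (dot_deriv n (F3 k i j) z) z"
    using has_dot_deriv_smooth[OF smooth3] z by simp
  note H = DERIV_cdivide[OF DERIV_add[OF DERIV_add[OF DERIV_add[OF
        DERIV_mult[OF deriv_F2[OF z, of k i n] deriv_l[OF z, of n j]]
        DERIV_mult[OF deriv_l[OF z, of n i] deriv_F2[OF z, of k j n]]]
        DERIV_mult[OF deriv_l[OF z, of n k] deriv_F2[OF z, of i j n]]]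
        DERIV_mult[OF deriv_F[OF z, of n] F3]], of 2, folded H_def]
  have H': "has_dot_deriv n H (dot_deriv n H z) z"
    using H unfolding dot_deriv_eqI[OF H] .
  have D: "has_dot_deriv n (\<lambda>z. C z i j k) (dot_deriv n H z) z"
    by (rule slit_cong[OF _ _ H']) (use z in \<open>auto simp: cartan_eq H_def\<close>)
  show ?thesis using D unfolding dot_deriv_eqI[OF D] .
qed

text \<open>Euler's relation, from differentiating \<open>F (z + t z) = (1 + t) F z\<close> at \<open>t = 0\<close>. Differentiating it
once and twice more gives the two lemmas that follow it.\<close>

lemma euler_supp_form:
  assumes z: "z \<noteq> 0"
  shows "(\<Sum>i\<in>UNIV. l z i * z $ i) = F z"
proof -
  have "((\<lambda>t. F (z + t *\<^sub>R z)) has_real_derivative dir_deriv z F z) (at 0)"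
    using DERIV_along_line[OF smooth, of z 0 z] z by simp
  moreover have "((\<lambda>t. F (z + t *\<^sub>R z)) has_real_derivative F z) (at 0)"
  proof (rule has_field_derivative_transform_within_open[where S = "{-1<..}"])
    show "((\<lambda>t. (1 + t) * F z) has_real_derivative F z) (at 0)"
      by (auto intro!: derivative_eq_intros)
    show "(1 + t) * F z = F (z + t *\<^sub>R z)" if "t \<in> {-1<..}" for t
      using homogeneous[OF z, of "1 + t"] that by (simp add: algebra_simps)
  qed auto
  ultimately have "dir_deriv z F z = F z" by (rule DERIV_unique)
  then show ?thesis
    using dir_deriv_eq_sum[OF smooth, of z z] z by (simp add: supp_form_def)
qed

lemma euler_F2:
  assumes z: "z \<noteq> 0"
  shows "(\<Sum>i\<in>UNIV. F2 k i z * z $ i) = 0"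
proof -
  have "has_dot_deriv k (\<lambda>z. \<Sum>i\<in>UNIV. l z i * z $ i)
     (\<Sum>i\<in>UNIV. F2 k i z * z $ i + l z i * (if i = k then 1 else 0)) z"
    by (rule DERIV_sum, rule DERIV_cong[OF DERIV_mult[OF deriv_l[OF z] has_dot_deriv_coord]]) simp
  then have "has_dot_deriv k F (\<Sum>i\<in>UNIV. F2 k i z * z $ i + l z i * (if i = k then 1 else 0)) z"
    by (rule slit_cong[rotated 2]) (use z euler_supp_form in auto)
  from has_dot_deriv_unique[OF this deriv_F[OF z]] show ?thesis
    by (simp add: sum.distrib if_distrib[of "\<lambda>x. _ * x"] cong: if_cong)
qed

lemma euler_F3:
  assumes z: "z \<noteq> 0"
  shows "(\<Sum>i\<in>UNIV. F3 k j i z * z $ i) = - F2 j k z"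
proof -
  have "has_dot_deriv k (\<lambda>z. \<Sum>i\<in>UNIV. F2 j i z * z $ i)
     (\<Sum>i\<in>UNIV. F3 k j i z * z $ i + F2 j i z * (if i = k then 1 else 0)) z"
    by (rule DERIV_sum, rule DERIV_cong[OF DERIV_mult[OF deriv_F2[OF z] has_dot_deriv_coord]]) simp
  then have "has_dot_deriv k (\<lambda>z. 0) (\<Sum>i\<in>UNIV. F3 k j i z * z $ i + F2 j i z * (if i = k then 1 else 0)) z"
    by (rule slit_cong[rotated 2]) (use z euler_F2 in auto)
  from has_dot_deriv_unique[OF this DERIV_const] show ?thesis
    by (simp add: sum.distrib if_distrib[of "\<lambda>x. _ * x"] cong: if_cong)
qed

lemma euler_ang_metric: "z \<noteq> 0 \<Longrightarrow> (\<Sum>i\<in>UNIV. h z k i * z $ i) = 0"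
  using euler_F2[of z k] by (simp add: ang_metric_eq mult.assoc sum_distrib_left[symmetric])

lemma euler_fund_tensor:
  assumes z: "z \<noteq> 0"
  shows "(\<Sum>i\<in>UNIV. g z k i * z $ i) = F z * l z k"
proof -
  have "(\<Sum>i\<in>UNIV. g z k i * z $ i) = (\<Sum>i\<in>UNIV. h z k i * z $ i) + l z k * (\<Sum>i\<in>UNIV. l z i * z $ i)"
    by (simp add: ang_metric_def sum_distrib_left sum.distrib[symmetric] algebra_simps)
  then show ?thesis by (simp add: euler_ang_metric[OF z] euler_supp_form[OF z])
qed

lemma euler_cartan:
  assumes z: "z \<noteq> 0"
  shows "(\<Sum>i\<in>UNIV. C z i j k * z $ i) = 0"
proof -
  have eq: "C z i j k * z $ i = (F2 k i z * z $ i) * l z j / 2 + (l z i * z $ i) * F2 k j z / 2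
      + (F2 j i z * z $ i) * l z k / 2 + (F3 k j i z * z $ i) * F z / 2" for i
    unfolding cartan_eq[OF z] F2_sym[OF z, of i j] F3_sym(2)[OF z, of k i j]
    by (simp add: algebra_simps add_divide_distrib)
  show ?thesis
    unfolding eq sum.distrib sum_divide_distrib[symmetric] sum_distrib_right[symmetric]
      euler_F2[OF z] euler_F3[OF z] euler_supp_form[OF z]
    by (simp add: F2_sym[OF z, of j k])
qed

text \<open>Index raising by the inverse metric, and the induced symmetric form on covectors. Every contraction
in the T-tensor is a value of this form.\<close>

definition raise where "raise z u i = (\<Sum>j\<in>UNIV. ginv z i j * u j)"

lemma
  assumes z: "z \<noteq> 0"
  shows fund_tensor_raise: "(\<Sum>j\<in>UNIV. g z i j * raise z u j) = u i"
    and raise_fund_tensor: "raise z (\<lambda>i. \<Sum>j\<in>UNIV. g z i j * w j) i = w i"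
proof -
  define G where "G = (\<chi> i j. g z i j)"
  have inv: "G ** matrix_inv G = mat 1" "matrix_inv G ** G = mat 1"
    using nondegenerate[OF z] unfolding G_def invertible_def matrix_inv_def
    by (metis (mono_tags, lifting) someI_ex)+
  have G: "g z i j = G $ i $ j" "ginv z i j = matrix_inv G $ i $ j" for i j
    by (simp_all add: G_def fund_inv_def)
  have r: "raise z u = (\<lambda>i. (matrix_inv G *v (\<chi> i. u i)) $ i)" for u
    by (simp add: raise_def G matrix_vector_mult_def fun_eq_iff)
  have "(\<Sum>j\<in>UNIV. g z i j * raise z u j) = (G *v (matrix_inv G *v (\<chi> i. u i))) $ i"
    unfolding r G by (simp add: matrix_vector_mult_def[of G])
  then show "(\<Sum>j\<in>UNIV. g z i j * raise z u j) = u i"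
    by (simp add: matrix_vector_mul_assoc inv)
  have "raise z (\<lambda>i. \<Sum>j\<in>UNIV. g z i j * w j) i = (matrix_inv G *v (G *v (\<chi> i. w i))) $ i"
    unfolding r G by (simp add: matrix_vector_mult_def[of G])
  then show "raise z (\<lambda>i. \<Sum>j\<in>UNIV. g z i j * w j) i = w i"
    by (simp add: matrix_vector_mul_assoc inv)
qed

lemma raise_unique:
  assumes "z \<noteq> 0" "\<And>i. (\<Sum>j\<in>UNIV. g z i j * w j) = u i"
  shows "raise z u i = w i"
proof -
  have "u = (\<lambda>i. \<Sum>j\<in>UNIV. g z i j * w j)" using assms(2) by auto
  then show ?thesis using raise_fund_tensor[OF assms(1)] by metis
qed

definition ip where "ip z u v = (\<Sum>i\<in>UNIV. u i * raise z v i)"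

lemma ip_commute:
  assumes z: "z \<noteq> 0"
  shows "ip z u v = ip z v u"
proof -
  have "ip z u v = (\<Sum>i\<in>UNIV. (\<Sum>j\<in>UNIV. g z i j * raise z u j) * raise z v i)"
    by (simp add: ip_def fund_tensor_raise[OF z])
  also have "\<dots> = (\<Sum>j\<in>UNIV. (\<Sum>i\<in>UNIV. g z j i * raise z v i) * raise z u j)"
    unfolding sum_distrib_right by (subst sum.swap) (simp add: fund_tensor_sym[OF z] mult_ac)
  also have "\<dots> = ip z v u"
    by (simp add: ip_def fund_tensor_raise[OF z])
  finally show ?thesis .
qed

lemma ip_add_left: "ip z (\<lambda>i. u i + v i) w = ip z u w + ip z v w"
  by (simp add: ip_def sum.distrib algebra_simps)

lemma ip_scale_left: "ip z (\<lambda>i. a * u i) w = a * ip z u w"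
  by (simp add: ip_def sum_distrib_left mult.assoc)

lemma raise_supp_form: "z \<noteq> 0 \<Longrightarrow> raise z (l z) i = z $ i / F z"
  using F_nonzero[of z]
  by (intro raise_unique)
    (auto simp: euler_fund_tensor sum_divide_distrib[symmetric] times_divide_eq_right)

text \<open>The angular metric is the metric minus \<open>l\<^sub>r l\<^sub>i\<close>, and raising \<open>l\<close> gives \<open>z / F z\<close>, which \<open>v\<close> annihilates.\<close>

lemma ip_ang_metric:
  assumes z: "z \<noteq> 0" and v: "(\<Sum>i\<in>UNIV. v i * z $ i) = 0"
  shows "ip z (\<lambda>r. h z r i) v = v i"
proof -
  have "ip z (l z) v = ip z v (l z)" by (rule ip_commute[OF z])
  also have "\<dots> = 0"
    by (simp add: ip_def raise_supp_form[OF z] v sum_divide_distrib[symmetric])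
  finally have l: "ip z (l z) v = 0" .
  have "ip z (\<lambda>r. h z r i) v = (\<Sum>r\<in>UNIV. g z i r * raise z v r) - l z i * ip z (l z) v"
    by (simp add: ip_def ang_metric_def sum_distrib_left sum_subtractf[symmetric]
        fund_tensor_sym[OF z, of i] algebra_simps)
  then show ?thesis by (simp add: l fund_tensor_raise[OF z])
qed

lemma T_tensor_eq:
  assumes z: "z \<noteq> 0"
  shows "T_tensor F z i j k n = F z * (dot_deriv n (\<lambda>w. C w i j k) z
      - ip z (\<lambda>r. C z r j k) (\<lambda>r. C z r i n) - ip z (\<lambda>r. C z r i k) (\<lambda>r. C z r j n)
      - ip z (\<lambda>r. C z r i j) (\<lambda>r. C z r k n))
     + C z i j k * l z n + C z i j n * l z k + C z i k n * l z j + C z j k n * l z i"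
proof -
  have s: "C z i m k = C z m i k" "C z i j m = C z m i j" for m
    using cartan_sym[OF z] by metis+
  show ?thesis
    by (simp add: T_tensor_def cartan_vcov_def ip_def raise_def cartan_up_def s)
qed

end

section \<open>Homogeneous functions of two variables\<close>

lemma dir_deriv_linear:
  assumes "smooth_on S \<Phi>" "z \<in> S"
  shows "linear (\<lambda>v. dir_deriv v \<Phi> z)"
  using smooth_on_has_derivative[OF assms] has_derivative_linear by blast

lemma partial1_eq_dir_deriv:
  assumes "smooth_on D (\<lambda>(u, v). \<phi> u v)" "(u, v) \<in> D"
  shows "partial1 \<phi> u v = dir_deriv (1, 0) (\<lambda>(u, v). \<phi> u v) (u, v)"
proof -
  have "((\<lambda>t. \<phi> (u + t) v) has_real_derivative dir_deriv (1, 0) (\<lambda>(u, v). \<phi> u v) (u, v)) (at 0)"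
    using DERIV_along_line[OF assms(1), of "(u, v)" 0 "(1, 0)"] assms(2) by simp
  then have "((\<lambda>s. \<phi> s v) has_real_derivative dir_deriv (1, 0) (\<lambda>(u, v). \<phi> u v) (u, v)) (at u)"
    using DERIV_shift[of "\<lambda>s. \<phi> s v" _ 0 u] by (simp add: add.commute)
  then show ?thesis
    unfolding partial1_def by (rule DERIV_imp_deriv)
qed

lemma partial2_eq_dir_deriv:
  assumes "smooth_on D (\<lambda>(u, v). \<phi> u v)" "(u, v) \<in> D"
  shows "partial2 \<phi> u v = dir_deriv (0, 1) (\<lambda>(u, v). \<phi> u v) (u, v)"
proof -
  have "((\<lambda>t. \<phi> u (v + t)) has_real_derivative dir_deriv (0, 1) (\<lambda>(u, v). \<phi> u v) (u, v)) (at 0)"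
    using DERIV_along_line[OF assms(1), of "(u, v)" 0 "(0, 1)"] assms(2) by simp
  then have "((\<lambda>s. \<phi> u s) has_real_derivative dir_deriv (0, 1) (\<lambda>(u, v). \<phi> u v) (u, v)) (at v)"
    using DERIV_shift[of "\<lambda>s. \<phi> u s" _ 0 v] by (simp add: add.commute)
  then show ?thesis
    unfolding partial2_def by (rule DERIV_imp_deriv)
qed

lemma smooth_on_partial1:
  assumes "open D" "smooth_on D (\<lambda>(u, v). \<phi> u v)"
  shows "smooth_on D (\<lambda>(u, v). partial1 \<phi> u v)"
  by (rule smooth_on_cong[OF assms(1) _ smooth_on_dir_deriv[OF assms(2), of "(1, 0)"]])
    (auto simp: partial1_eq_dir_deriv[OF assms(2)])

lemma smooth_on_partial2:
  assumes "open D" "smooth_on D (\<lambda>(u, v). \<phi> u v)"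
  shows "smooth_on D (\<lambda>(u, v). partial2 \<phi> u v)"
  by (rule smooth_on_cong[OF assms(1) _ smooth_on_dir_deriv[OF assms(2), of "(0, 1)"]])
    (auto simp: partial2_eq_dir_deriv[OF assms(2)])

text \<open>Homogeneity of degree \<open>d\<close>, expressed by Euler's relation: in this form it is inherited by partial
derivatives through differentiation of an identity.\<close>

definition euler_homogeneous :: "(real \<times> real) set \<Rightarrow> real \<Rightarrow> (real \<Rightarrow> real \<Rightarrow> real) \<Rightarrow> bool" where
  "euler_homogeneous D d \<phi> \<longleftrightarrow> open D \<and> smooth_on D (\<lambda>(u, v). \<phi> u v) \<and>
     (\<forall>u v. (u, v) \<in> D \<longrightarrow> u * partial1 \<phi> u v + v * partial2 \<phi> u v = d * \<phi> u v)"

text \<open>Differentiate Euler's relation in the second variable and exchange the mixed derivatives.\<close>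

lemma euler_homogeneous_partial2:
  assumes "euler_homogeneous D d \<phi>"
  shows "euler_homogeneous D (d - 1) (partial2 \<phi>)"
proof -
  let ?\<Phi> = "\<lambda>(u, v). \<phi> u v" and ?P = "\<lambda>(u, v). partial2 \<phi> u v"
  have D: "open D" and \<Phi>: "smooth_on D ?\<Phi>"
    and euler: "\<And>u v. (u, v) \<in> D \<Longrightarrow> u * partial1 \<phi> u v + v * partial2 \<phi> u v = d * \<phi> u v"
    using assms unfolding euler_homogeneous_def by blast+
  note P = smooth_on_partial2[OF D \<Phi>]
  have "u * partial1 (partial2 \<phi>) u v + v * partial2 (partial2 \<phi>) u v = (d - 1) * partial2 \<phi> u v"
    if uv: "(u, v) \<in> D" for u v
  proof -
    let ?P1 = "dir_deriv (1, 0) ?\<Phi>" and ?P2 = "dir_deriv (0, 1) ?\<Phi>"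
    note along = DERIV_along_line[of D _ "(u, v)" 0 "(0, 1)"]
    define H where "H w = fst w * ?P1 w + snd w * ?P2 w" for w
    have P1: "((\<lambda>t. ?P1 (u, v + t)) has_real_derivative dir_deriv (0, 1) ?P1 (u, v)) (at 0)"
      using along[OF smooth_on_dir_deriv[OF \<Phi>]] uv by simp
    have P2: "((\<lambda>t. ?P2 (u, v + t)) has_real_derivative dir_deriv (0, 1) ?P2 (u, v)) (at 0)"
      using along[OF smooth_on_dir_deriv[OF \<Phi>]] uv by simp
    have id: "((\<lambda>t. v + t) has_real_derivative 1) (at 0)"
      by (auto intro!: derivative_eq_intros)
    have H: "((\<lambda>t. H ((u, v) + t *\<^sub>R (0, 1))) has_real_derivative
        u * dir_deriv (0, 1) ?P1 (u, v) + (?P2 (u, v) + v * dir_deriv (0, 1) ?P2 (u, v))) (at 0)"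
      using DERIV_add[OF DERIV_cmult[OF P1, of u] DERIV_mult[OF id P2]]
      by (simp add: H_def algebra_simps)
    have "((\<lambda>t. d * ?\<Phi> ((u, v) + t *\<^sub>R (0, 1))) has_real_derivative
        u * dir_deriv (0, 1) ?P1 (u, v) + (?P2 (u, v) + v * dir_deriv (0, 1) ?P2 (u, v))) (at 0)"
    proof (rule has_real_derivative_near[OF D uv _ H])
      show "H w = d * ?\<Phi> w" if "w \<in> D" for w
        using that euler[of "fst w" "snd w"]
        by (cases w) (simp add: H_def partial1_eq_dir_deriv[OF \<Phi>] partial2_eq_dir_deriv[OF \<Phi>])
    qed
    moreover have "((\<lambda>t. d * ?\<Phi> ((u, v) + t *\<^sub>R (0, 1))) has_real_derivative d * ?P2 (u, v)) (at 0)"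
      using DERIV_cmult[OF along[OF \<Phi>], of d] uv by simp
    ultimately have "u * dir_deriv (0, 1) ?P1 (u, v) + (?P2 (u, v) + v * dir_deriv (0, 1) ?P2 (u, v))
        = d * ?P2 (u, v)"
      by (rule DERIV_unique)
    moreover have "dir_deriv a ?P (u, v) = dir_deriv a ?P2 (u, v)" for a
      by (rule dir_deriv_cong[OF D _ P uv]) (auto simp: partial2_eq_dir_deriv[OF \<Phi>])
    ultimately show ?thesis
      using dir_deriv_commute[OF \<Phi> D uv, of "(0, 1)" "(1, 0)"]
      by (simp add: partial1_eq_dir_deriv[OF P uv] partial2_eq_dir_deriv[OF P uv]
          partial2_eq_dir_deriv[OF \<Phi> uv] algebra_simps)
  qed
  with D P show ?thesis unfolding euler_homogeneous_def by blast
qed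

lemma homogeneous_function_euler:
  assumes "homogeneous_function D f"
  shows "euler_homogeneous D 1 f"
proof -
  let ?\<Phi> = "\<lambda>(u, v). f u v"
  have D: "open D" and \<Phi>: "smooth_on D ?\<Phi>"
    and hom: "\<And>u v t. (u, v) \<in> D \<Longrightarrow> t > 0 \<Longrightarrow> f (t * u) (t * v) = t * f u v"
    using assms unfolding homogeneous_function_def by blast+
  have "u * partial1 f u v + v * partial2 f u v = 1 * f u v" if uv: "(u, v) \<in> D" for u v
  proof -
    have lin: "linear (\<lambda>w. dir_deriv w ?\<Phi> (u, v))" by (rule dir_deriv_linear[OF \<Phi> uv])
    have "((\<lambda>t. ?\<Phi> ((u, v) + t *\<^sub>R (u, v))) has_real_derivative dir_deriv (u, v) ?\<Phi> (u, v)) (at 0)"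
      using DERIV_along_line[OF \<Phi>, of "(u, v)" 0 "(u, v)"] uv by simp
    moreover have "((\<lambda>t. ?\<Phi> ((u, v) + t *\<^sub>R (u, v))) has_real_derivative f u v) (at 0)"
    proof (rule has_field_derivative_transform_within_open[where S = "{-1<..}"])
      show "((\<lambda>t. (1 + t) * f u v) has_real_derivative f u v) (at 0)"
        by (auto intro!: derivative_eq_intros)
      show "(1 + t) * f u v = ?\<Phi> ((u, v) + t *\<^sub>R (u, v))" if "t \<in> {-1<..}" for t
        using hom[OF uv, of "1 + t"] that by (simp add: algebra_simps)
    qed auto
    ultimately have "dir_deriv (u, v) ?\<Phi> (u, v) = f u v" by (rule DERIV_unique)
    moreover have "dir_deriv (u, v) ?\<Phi> (u, v)
        = dir_deriv (u *\<^sub>R (1, 0) + v *\<^sub>R (0, 1)) ?\<Phi> (u, v)"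
      by simp
    ultimately show ?thesis
      unfolding linear_add[OF lin] linear_scale[OF lin]
      by (simp add: partial1_eq_dir_deriv[OF \<Phi> uv] partial2_eq_dir_deriv[OF \<Phi> uv])
  qed
  with D \<Phi> show ?thesis unfolding euler_homogeneous_def by blast
qed

section \<open>Collecting the coefficients\<close>

text \<open>The tensor identity behind the theorem, where the symbols \<open>iA\<close>, \<open>iL\<close> and \<open>iw\<close> stand
for the inverses of \<open>A\<close>, of \<open>F\<close> and of \<open>A + q\<^sub>0 m\<^sup>2\<close>, and \<open>L\<close> for the changed norm. Because \<open>iw = iA - s m\<^sup>2\<close> and
\<open>A iw = 1 - A s m\<^sup>2\<close>, no division remains and the claim is an identity of polynomials.
Each of the three pairings of the indices \<open>a, i, j, k\<close> contributes one term \<open>Q\<close>. This explains the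
coefficients: the derivative of the barred Cartan tensor contributes \<open>2 B\<close> to each product \<open>C m\<close>
and each pairing takes \<open>B\<close> away, which leaves \<open>- B\<close>; a product \<open>h\<^sub>i\<^sub>j m\<^sub>a m\<^sub>k\<close> receives \<open>2 B\<^sup>2 iA\<close> from the
pairing that contains the block \<open>i j\<close> and \<open>B\<^sup>2 iA\<close> from each of the other two.\<close>

lemma T_tensor_algebra:
  fixes h Cm X :: "'i \<Rightarrow> 'i \<Rightarrow> real" and C Cb :: "'i \<Rightarrow> 'i \<Rightarrow> 'i \<Rightarrow> real"
    and m l lb :: "'i \<Rightarrow> real" and CC Q :: "'i \<Rightarrow> 'i \<Rightarrow> 'i \<Rightarrow> 'i \<Rightarrow> real"
    and A B D E L iL iA iw s msq bt f2 dC dCb :: real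
  assumes h: "\<And>i j. h i j = h j i"
    and C: "\<And>i j k. C i j k = C j i k" "\<And>i j k. C i j k = C i k j"
    and Cm: "\<And>i j. Cm i j = Cm j i"
    and iw: "iw = iA - s * msq"
    and A_iw: "A_iw = 1 - A * s * msq"
    and lb: "\<And>i. lb i = f2 * m i + L * iL * l i"
    and Cb: "\<And>i j k. Cb i j k = A * C i j k + B * (h i j * m k + h i k * m j + h j k * m i)
        + D * (m i * m j * m k)"
    and X: "\<And>i j. X i j = A * Cm i j + B * (2 * m i * m j + h i j * msq) + D * msq * m i * m j"
    and Q: "\<And>i j k n. Q i j k n = A * CC i j k n
        + B * (h k n * Cm i j + h i j * Cm k n + C i k n * m j + C j k n * m i
          + C k i j * m n + C n i j * m k)
        + D * (m k * m n * Cm i j + m i * m j * Cm k n)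
        + iA * (B\<^sup>2 * (h i j * h k n * msq + 2 * h i j * m k * m n + 2 * h k n * m i * m j
            + h i k * m j * m n + h i n * m j * m k + h j k * m i * m n + h j n * m i * m k)
          + B * D * (msq * (h i j * m k * m n + h k n * m i * m j) + 4 * m i * m j * m k * m n)
          + D\<^sup>2 * msq * m i * m j * m k * m n)
        - s * X i j * X k n"
    and dCb: "dCb = 2 * B * m k * C a i j + A * dC
      + (- bt * D * iL\<^sup>2 * m k - B * l k * iL) * (h a i * m j + h a j * m i + h i j * m a)
      + B * ((2 * C a i k - (h a k * l i + h i k * l a) * iL) * m j
        + h a i * (- (bt * iL\<^sup>2 * h j k) - m k * l j * iL)
        + (2 * C a j k - (h a k * l j + h j k * l a) * iL) * m i
        + h a j * (- (bt * iL\<^sup>2 * h i k) - m k * l i * iL)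
        + (2 * C i j k - (h i k * l j + h j k * l i) * iL) * m a
        + h i j * (- (bt * iL\<^sup>2 * h a k) - m k * l a * iL))
      + (E * m k - D * l k * iL) * (m a * m i * m j)
      + D * ((- (bt * iL\<^sup>2 * h a k) - m k * l a * iL) * m i * m j
        + m a * (- (bt * iL\<^sup>2 * h i k) - m k * l i * iL) * m j
        + m a * m i * (- (bt * iL\<^sup>2 * h j k) - m k * l j * iL))"
    and nn: "\<And>i j. nn i j = l i * m j + l j * m i"
    and nd: "\<And>i j. nd i j = lb i * m j + lb j * m i"
    and M: "\<And>i j. M i j = (B - A * B * s * msq) * h i j + (A_iw * D - 2 * A * B * s) * m i * m j"
    and \<nu>: "\<And>i j. \<nu> i j = B * nd i j
        - L * (B\<^sup>2 * iA - 2 * B\<^sup>2 * s * msq + B * D * msq * iw + 3 * (B\<^sup>2 * iA) + bt * D * iL\<^sup>2) * m i * m j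
        - L * B * iL * nn i j"
  shows "L * (dCb - Q i j a k - Q a j i k - Q a i j k)
      + Cb a i j * lb k + Cb a i k * lb j + Cb a j k * lb i + Cb i j k * lb a =
      A * L * (dC - CC i j a k - CC a j i k - CC a i j k)
      + A * L * iL * (C a i j * l k + C a i k * l j + C a j k * l i + C i j k * l a)
      - L * (bt * B * iL\<^sup>2 + B\<^sup>2 * msq * iw) * (h a i * h j k + h a j * h i k + h a k * h i j)
      + (h a i * \<nu> j k + h a j * \<nu> i k + h i j * \<nu> a k + h j k * \<nu> i a + h a k * \<nu> i j + h i k * \<nu> j a)
      + (A * f2 - L * B) * (C a i j * m k + C i j k * m a + C j a k * m i + C a i k * m j)
      - L * (M i j * Cm a k + M j a * Cm i k + M i a * Cm j k + M a k * Cm i j + M j k * Cm i a + M i k * Cm j a)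
      + L * s * A\<^sup>2 * (Cm i j * Cm a k + Cm a j * Cm i k + Cm i a * Cm j k)
      + L * (3 * (4 * s * B\<^sup>2 - (4 * B * D + D\<^sup>2 * msq) * iw) + E) * m a * m i * m j * m k
      - L * D * iL * (nn i j * m k * m a + nn a k * m i * m j)
      + D * (nd i j * m k * m a + nd a k * m i * m j)"
proof -
  have hs: "h i a = h a i" "h j a = h a j" "h k a = h a k" "h j i = h i j" "h k i = h i k" "h k j = h j k"
    by (rule h)+
  have Cms: "Cm i a = Cm a i" "Cm j a = Cm a j" "Cm k a = Cm a k" "Cm j i = Cm i j" "Cm k i = Cm i k" "Cm k j = Cm j k"
    by (rule Cm)+
  have Cs: "C j a k = C a j k" "C j i k = C i j k" "C i a k = C a i k"
    "C a k j = C a j k" "C i k j = C i j k" "C a k i = C a i k"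
    "C k a j = C a j k" "C k i j = C i j k" "C k a i = C a i k" "C j a i = C a i j" "C i a j = C a i j"
    "C j i a = C a i j" "C i j a = C a i j" "C a j i = C a i j" "C j a k = C a j k" "C j k a = C a j k"
    "C i k a = C a i k" "C k j a = C a j k" "C k i a = C a i k" "C k j i = C i j k" "C j k i = C i j k"
    using C by metis+
  show ?thesis
    unfolding dCb Q X Cb M \<nu> nn nd lb iw A_iw
    by (simp only: hs Cms Cs) (simp add: algebra_simps power2_eq_square)
qed

section \<open>Vertical derivatives under a beta-change\<close>

locale beta_change = F: minkowski_norm F + Fb: minkowski_norm Fb
  for F Fb :: "real ^ 'n::finite \<Rightarrow> real" +
  fixes f :: "real \<Rightarrow> real \<Rightarrow> real" and D and es :: real and \<beta> :: "real ^ 'n \<Rightarrow> real"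
  assumes f_hom: "euler_homogeneous D 1 f"
    and es_pos: "es > 0"
    and linear_\<beta>: "linear \<beta>"
    and in_D: "z \<noteq> 0 \<Longrightarrow> (es * F z, \<beta> z) \<in> D"
    and Fb_eq: "Fb z = f (es * F z) (\<beta> z)"
begin

definition b where "b k = \<beta> (axis k 1)"

text \<open>On the fibre \<open>y\<^sub>k = F l\<^sub>k\<close>, hence \<open>m\<^sub>k = b\<^sub>k - (\<beta> / F) l\<^sub>k\<close>; these are \<open>F\<close> times the components of the
differential of \<open>\<beta> / F\<close>.\<close>

definition m where "m z k = b k - \<beta> z / F z * F.l z k"
definition pull where "pull \<phi> z = \<phi> (es * F z) (\<beta> z)"

lemma deriv_\<beta>: "has_dot_deriv k \<beta> (b k) z"
proof -
  have "\<beta> (z + t *\<^sub>R axis k 1) = \<beta> z + t * b k" for t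
    by (simp add: b_def linear_add[OF linear_\<beta>] linear_scale[OF linear_\<beta>])
  then show ?thesis by (auto intro!: derivative_eq_intros)
qed

text \<open>By the chain rule the derivative is \<open>e\<^sup>\<sigma> l\<^sub>k \<phi>\<^sub>1 + b\<^sub>k \<phi>\<^sub>2\<close>, and Euler's relation replaces
\<open>e\<^sup>\<sigma> F \<phi>\<^sub>1\<close> by \<open>d \<phi> - \<beta> \<phi>\<^sub>2\<close>. What \<open>\<phi>\<^sub>2\<close> multiplies then is exactly \<open>m\<^sub>k\<close>.\<close>

lemma deriv_pull:
  assumes \<phi>: "euler_homogeneous D d \<phi>" and z: "z \<noteq> 0"
  shows "has_dot_deriv k (pull \<phi>) (pull (partial2 \<phi>) z * m z k + d * pull \<phi> z * F.l z k / F z) z"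
proof -
  let ?\<Phi> = "\<lambda>(u, v). \<phi> u v" and ?w = "(es * F z, \<beta> z)"
  have smooth: "smooth_on D ?\<Phi>"
    and euler: "es * F z * partial1 \<phi> (es * F z) (\<beta> z) + \<beta> z * partial2 \<phi> (es * F z) (\<beta> z)
      = d * \<phi> (es * F z) (\<beta> z)"
    using \<phi> in_D[OF z] unfolding euler_homogeneous_def by blast+
  have lin: "linear (\<lambda>w. dir_deriv w ?\<Phi> ?w)" by (rule dir_deriv_linear[OF smooth in_D[OF z]])
  have "((\<lambda>t. (es * F (z + t *\<^sub>R axis k 1), \<beta> (z + t *\<^sub>R axis k 1))) has_derivative
      (\<lambda>t. (t * (es * F.l z k), t * b k))) (at 0)"
    using DERIV_cmult[OF F.deriv_F[OF z, of k], of es] deriv_\<beta>[of z k]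
    by (intro has_derivative_Pair) (simp_all add: has_field_derivative_def mult_commute_abs)
  from has_derivative_compose[OF this, of ?\<Phi> "\<lambda>w. dir_deriv w ?\<Phi> ?w"]
  have "((\<lambda>t. pull \<phi> (z + t *\<^sub>R axis k 1)) has_derivative
      (\<lambda>t. dir_deriv (t * (es * F.l z k), t * b k) ?\<Phi> ?w)) (at 0)"
    using smooth_on_has_derivative[OF smooth in_D[OF z]] by (simp add: pull_def)
  moreover have "dir_deriv (t * (es * F.l z k), t * b k) ?\<Phi> ?w
      = (pull (partial2 \<phi>) z * m z k + d * pull \<phi> z * F.l z k / F z) * t" for t
  proof -
    have "dir_deriv (t * (es * F.l z k), t * b k) ?\<Phi> ?w
        = dir_deriv ((t * (es * F.l z k)) *\<^sub>R (1, 0) + (t * b k) *\<^sub>R (0, 1)) ?\<Phi> ?w"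
      by simp
    also have "\<dots> = t * (es * F.l z k * partial1 \<phi> (es * F z) (\<beta> z)
        + b k * partial2 \<phi> (es * F z) (\<beta> z))"
      unfolding linear_add[OF lin] linear_scale[OF lin]
      by (simp add: partial1_eq_dir_deriv[OF smooth in_D[OF z]]
          partial2_eq_dir_deriv[OF smooth in_D[OF z]] algebra_simps)
    also have "es * F.l z k * partial1 \<phi> (es * F z) (\<beta> z)
        = (d * \<phi> (es * F z) (\<beta> z) - \<beta> z * partial2 \<phi> (es * F z) (\<beta> z)) * F.l z k / F z"
      using F.F_nonzero[OF z] by (simp add: euler[symmetric])
    finally show ?thesis
      using F.F_nonzero[OF z] by (simp add: pull_def m_def field_simps)
  qed
  ultimately show ?thesis by (simp add: has_field_derivative_def)
qed

lemma deriv_m: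
  assumes z: "z \<noteq> 0"
  shows "has_dot_deriv k (\<lambda>z. m z i) (- (\<beta> z / (F z)\<^sup>2 * F.h z i k) - m z k * F.l z i / F z) z"
proof -
  have "has_dot_deriv k (\<lambda>z. m z i)
    (0 - ((b k * F z - \<beta> z * F.l z k) / (F z * F z) * F.l z i + F.h z i k / F z * (\<beta> z / F z))) z"
    unfolding m_def
    using DERIV_diff[OF DERIV_const[of "b i"]
      DERIV_mult[OF DERIV_divide[OF deriv_\<beta>[of z k] F.deriv_F[OF z, of k]] F.has_dot_deriv_supp_form[OF z, of k i]]]
      F.F_nonzero[OF z] by simp
  then show ?thesis
    by (rule DERIV_cong) (use F.F_nonzero[OF z] in \<open>simp add: m_def field_simps power2_eq_square\<close>)
qed

abbreviation f2 where "f2 \<equiv> pull (partial2 f)"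
abbreviation f22 where "f22 \<equiv> pull (partial2 (partial2 f))"
abbreviation f222 where "f222 \<equiv> pull (partial2 (partial2 (partial2 f)))"
abbreviation f2222 where "f2222 \<equiv> pull (partial2 (partial2 (partial2 (partial2 f))))"

lemma deriv_Fb: "z \<noteq> 0 \<Longrightarrow> has_dot_deriv k Fb (f2 z * m z k + Fb z * F.l z k / F z) z"
  using deriv_pull[OF f_hom, of z k] Fb_eq by (simp add: pull_def)

lemmas hom2 = euler_homogeneous_partial2[OF f_hom]
lemmas hom22 = euler_homogeneous_partial2[OF hom2]
lemmas hom222 = euler_homogeneous_partial2[OF hom22]

lemma deriv_f2: "z \<noteq> 0 \<Longrightarrow> has_dot_deriv k f2 (f22 z * m z k) z"
  using deriv_pull[OF hom2, of z k] by simp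

lemma deriv_f22: "z \<noteq> 0 \<Longrightarrow> has_dot_deriv k f22 (f222 z * m z k - f22 z * F.l z k / F z) z"
  using deriv_pull[OF hom22, of z k] by simp

lemma deriv_f222: "z \<noteq> 0 \<Longrightarrow> has_dot_deriv k f222 (f2222 z * m z k - 2 * f222 z * F.l z k / F z) z"
  using deriv_pull[OF hom222, of z k] by simp

text \<open>These are \<open>e\<^sup>\<sigma> p\<close>, \<open>e\<^sup>\<sigma> p\<^sub>-\<^sub>1 / 2\<close>, \<open>q\<^sub>0\<close>, \<open>p\<^sub>0\<^sub>2 / 2\<close> and \<open>p\<^sub>0\<^sub>2\<^sub>2 / 2\<close>, after Euler's relation has
removed the derivatives in the first argument of \<open>f\<close>.\<close>

definition cA where "cA z = Fb z * (Fb z - \<beta> z * f2 z) / (F z)\<^sup>2"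
definition cB where "cB z = ((Fb z - \<beta> z * f2 z) * f2 z - Fb z * \<beta> z * f22 z) / (2 * (F z)\<^sup>2)"
definition cq where "cq z = Fb z * f22 z"
definition cD where "cD z = (3 * f2 z * f22 z + Fb z * f222 z) / 2"
definition cE where "cE z = (3 * (f22 z)\<^sup>2 + 4 * f2 z * f222 z + Fb z * f2222 z) / 2"

lemma deriv_F_square: "z \<noteq> 0 \<Longrightarrow> has_dot_deriv k (\<lambda>z. (F z)\<^sup>2) (2 * F z * F.l z k) z"
  using DERIV_power[OF F.deriv_F, of z k 2] by (simp add: mult_ac)

lemma deriv_remainder:
  assumes z: "z \<noteq> 0"
  shows "has_dot_deriv k (\<lambda>z. Fb z - \<beta> z * f2 z)
     ((Fb z - \<beta> z * f2 z) * F.l z k / F z - \<beta> z * f22 z * m z k) z"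
  by (rule DERIV_cong[OF DERIV_diff[OF deriv_Fb[OF z, of k] DERIV_mult[OF deriv_\<beta>[of z k] deriv_f2[OF z, of k]]]])
    (use F.F_nonzero[OF z] in \<open>simp add: m_def field_simps\<close>)

lemma deriv_cA:
  assumes z: "z \<noteq> 0"
  shows "has_dot_deriv k cA (2 * cB z * m z k) z"
  unfolding cA_def[abs_def]
  by (rule DERIV_cong[OF DERIV_divide[OF DERIV_mult[OF deriv_Fb[OF z, of k] deriv_remainder[OF z, of k]]
    deriv_F_square[OF z, of k]]])
    (use F.F_nonzero[OF z] in \<open>simp_all add: cB_def field_simps power2_eq_square\<close>)

lemma deriv_cB:
  assumes z: "z \<noteq> 0"
  shows "has_dot_deriv k cB (- \<beta> z * cD z / (F z)\<^sup>2 * m z k - cB z * F.l z k / F z) z"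
  unfolding cB_def[abs_def]
  by (rule DERIV_cong[OF DERIV_divide[OF DERIV_diff[OF
      DERIV_mult[OF deriv_remainder[OF z, of k] deriv_f2[OF z, of k]]
      DERIV_mult[OF DERIV_mult[OF deriv_Fb[OF z, of k] deriv_\<beta>[of z k]] deriv_f22[OF z, of k]]]
      DERIV_cmult[OF deriv_F_square[OF z, of k], of 2]]])
    (use F.F_nonzero[OF z] in \<open>simp_all add: cD_def m_def field_simps power2_eq_square\<close>)

lemma deriv_cq:
  assumes z: "z \<noteq> 0"
  shows "has_dot_deriv k cq ((f2 z * f22 z + Fb z * f222 z) * m z k) z"
  unfolding cq_def[abs_def]
  by (rule DERIV_cong[OF DERIV_mult[OF deriv_Fb[OF z, of k] deriv_f22[OF z, of k]]])
    (simp add: field_simps)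

lemma deriv_cD:
  assumes z: "z \<noteq> 0"
  shows "has_dot_deriv k cD (cE z * m z k - cD z * F.l z k / F z) z"
  unfolding cD_def[abs_def]
  by (rule DERIV_cong[OF DERIV_cdivide[OF DERIV_add[OF
      DERIV_mult[OF DERIV_cmult[OF deriv_f2[OF z, of k], of 3] deriv_f22[OF z, of k]]
      DERIV_mult[OF deriv_Fb[OF z, of k] deriv_f222[OF z, of k]]], of 2]])
    (use F.F_nonzero[OF z] in \<open>simp add: cE_def field_simps power2_eq_square\<close>)

section \<open>The angular metric and the Cartan tensor of the changed norm\<close>

lemma supp_form_Fb: "z \<noteq> 0 \<Longrightarrow> Fb.l z k = f2 z * m z k + Fb z * F.l z k / F z"
  using has_dot_deriv_unique[OF Fb.deriv_F deriv_Fb] by blast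

lemma euler_m:
  assumes z: "z \<noteq> 0"
  shows "(\<Sum>i\<in>UNIV. m z i * z $ i) = 0"
proof -
  have "\<beta> z = \<beta> (\<Sum>i\<in>UNIV. z $ i *\<^sub>R axis i 1)"
    by (simp add: basis_expansion scalar_mult_eq_scaleR[symmetric])
  also have "\<dots> = (\<Sum>i\<in>UNIV. b i * z $ i)"
    by (simp add: linear_sum[OF linear_\<beta>] linear_scale[OF linear_\<beta>] b_def mult.commute)
  finally have b: "(\<Sum>i\<in>UNIV. b i * z $ i) = \<beta> z" ..
  have "(\<Sum>i\<in>UNIV. m z i * z $ i)
      = (\<Sum>i\<in>UNIV. b i * z $ i) - \<beta> z / F z * (\<Sum>i\<in>UNIV. F.l z i * z $ i)"
    by (simp add: m_def sum_distrib_left sum_subtractf[symmetric] algebra_simps)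
  then show ?thesis
    using F.F_nonzero[OF z] by (simp add: b F.euler_supp_form[OF z])
qed

text \<open>The barred angular metric is \<open>Fb\<close> times the derivative of \<open>f\<^sub>2 m\<^sub>i + (Fb / F) l\<^sub>i\<close>, the barred
supporting form; the products \<open>m\<^sub>k l\<^sub>i\<close> and \<open>l\<^sub>k l\<^sub>i\<close> cancel.\<close>

lemma ang_metric_Fb:
  assumes z: "z \<noteq> 0"
  shows "Fb.h z i k = cA z * F.h z i k + cq z * m z i * m z k"
proof -
  have "has_dot_deriv k (\<lambda>z. f2 z * m z i + Fb z * F.l z i / F z)
     (f22 z * m z k * m z i + f2 z * (- (\<beta> z / (F z)\<^sup>2 * F.h z i k) - m z k * F.l z i / F z)
      + (((f2 z * m z k + Fb z * F.l z k / F z) * F.l z i + Fb z * (F.h z i k / F z)) * F z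
        - Fb z * F.l z i * F.l z k) / (F z * F z)) z"
    by (rule DERIV_cong[OF DERIV_add[OF DERIV_mult[OF deriv_f2[OF z, of k] deriv_m[OF z, of k i]]
        DERIV_divide[OF DERIV_mult[OF deriv_Fb[OF z, of k] F.has_dot_deriv_supp_form[OF z, of k i]]
          F.deriv_F[OF z, of k]]]])
      (use F.F_nonzero[OF z] in \<open>simp_all add: algebra_simps\<close>)
  then have "has_dot_deriv k (\<lambda>z. Fb.l z i)
     (f22 z * m z k * m z i + f2 z * (- (\<beta> z / (F z)\<^sup>2 * F.h z i k) - m z k * F.l z i / F z)
      + (((f2 z * m z k + Fb z * F.l z k / F z) * F.l z i + Fb z * (F.h z i k / F z)) * F z
        - Fb z * F.l z i * F.l z k) / (F z * F z)) z"
    by (rule F.slit_cong[rotated 2]) (use z supp_form_Fb in auto)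
  from has_dot_deriv_unique[OF Fb.has_dot_deriv_supp_form[OF z, of k i] this]
  have "Fb.h z i k = Fb z * (f22 z * m z k * m z i
      + f2 z * (- (\<beta> z / (F z)\<^sup>2 * F.h z i k) - m z k * F.l z i / F z)
      + (((f2 z * m z k + Fb z * F.l z k / F z) * F.l z i + Fb z * (F.h z i k / F z)) * F z
        - Fb z * F.l z i * F.l z k) / (F z * F z))"
    using Fb.F_nonzero[OF z] by (simp only: divide_eq_eq if_False mult.commute simp_thms)
  also have "\<dots> = cA z * F.h z i k + cq z * m z i * m z k"
    using F.F_nonzero[OF z] by (simp add: cA_def cq_def field_simps power2_eq_square)
  finally show ?thesis .
qed

text \<open>Differentiate the barred angular metric. The supporting forms \<open>l\<close> cancel between the two derivative
rules, and the remaining coefficients of \<open>h m\<close> and \<open>m m m\<close> turn out to be \<open>2 B\<close> and \<open>2 D\<close>.\<close>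

lemma cartan_Fb:
  assumes z: "z \<noteq> 0"
  shows "Fb.C z i j k = cA z * F.C z i j k
    + cB z * (F.h z i j * m z k + F.h z i k * m z j + F.h z j k * m z i)
    + cD z * (m z i * m z j * m z k)"
proof -
  have "has_dot_deriv k (\<lambda>z. cA z * F.h z i j + cq z * m z i * m z j)
     (2 * cB z * m z k * F.h z i j
      + cA z * (2 * F.C z i j k - (F.h z i k * F.l z j + F.h z j k * F.l z i) / F z)
      + (f2 z * f22 z + Fb z * f222 z) * m z k * m z i * m z j
      + cq z * (- (\<beta> z / (F z)\<^sup>2 * F.h z i k) - m z k * F.l z i / F z) * m z j
      + cq z * m z i * (- (\<beta> z / (F z)\<^sup>2 * F.h z j k) - m z k * F.l z j / F z)) z"
    by (rule DERIV_cong[OF DERIV_add[OF DERIV_mult[OF deriv_cA[OF z, of k] F.has_dot_deriv_ang_metric[OF z, of k i j]]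
        DERIV_mult[OF DERIV_mult[OF deriv_cq[OF z, of k] deriv_m[OF z, of k i]] deriv_m[OF z, of k j]]]])
      (simp add: algebra_simps)
  then have "has_dot_deriv k (\<lambda>z. Fb.h z i j)
     (2 * cB z * m z k * F.h z i j
      + cA z * (2 * F.C z i j k - (F.h z i k * F.l z j + F.h z j k * F.l z i) / F z)
      + (f2 z * f22 z + Fb z * f222 z) * m z k * m z i * m z j
      + cq z * (- (\<beta> z / (F z)\<^sup>2 * F.h z i k) - m z k * F.l z i / F z) * m z j
      + cq z * m z i * (- (\<beta> z / (F z)\<^sup>2 * F.h z j k) - m z k * F.l z j / F z)) z"
    by (rule F.slit_cong[rotated 2]) (use z ang_metric_Fb in auto)
  from has_dot_deriv_unique[OF Fb.has_dot_deriv_ang_metric[OF z, of k i j] this]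
  have "2 * Fb.C z i j k = (Fb.h z i k * Fb.l z j + Fb.h z j k * Fb.l z i) / Fb z
      + (2 * cB z * m z k * F.h z i j
      + cA z * (2 * F.C z i j k - (F.h z i k * F.l z j + F.h z j k * F.l z i) / F z)
      + (f2 z * f22 z + Fb z * f222 z) * m z k * m z i * m z j
      + cq z * (- (\<beta> z / (F z)\<^sup>2 * F.h z i k) - m z k * F.l z i / F z) * m z j
      + cq z * m z i * (- (\<beta> z / (F z)\<^sup>2 * F.h z j k) - m z k * F.l z j / F z))"
    by simp
  also have "\<dots> = 2 * cA z * F.C z i j k + 2 * cB z * m z k * F.h z i j
      + (cA z * f2 z / Fb z - cq z * \<beta> z / (F z)\<^sup>2) * (F.h z i k * m z j + F.h z j k * m z i)
      + (f2 z * f22 z + Fb z * f222 z + 2 * cq z * f2 z / Fb z) * (m z i * m z j * m z k)"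
    unfolding ang_metric_Fb[OF z] supp_form_Fb[OF z]
    using F.F_nonzero[OF z] Fb.F_nonzero[OF z] by (simp add: field_simps power2_eq_square)
  also have "cA z * f2 z / Fb z - cq z * \<beta> z / (F z)\<^sup>2 = 2 * cB z"
    using F.F_nonzero[OF z] Fb.F_nonzero[OF z]
    by (simp add: cA_def cB_def cq_def field_simps power2_eq_square)
  also have "f2 z * f22 z + Fb z * f222 z + 2 * cq z * f2 z / Fb z = 2 * cD z"
    using Fb.F_nonzero[OF z] by (simp add: cq_def cD_def)
  finally show ?thesis by (simp add: algebra_simps)
qed

lemma dot_deriv_cartan_Fb:
  assumes z: "z \<noteq> 0"
  shows "dot_deriv n (\<lambda>z. Fb.C z i j k) z = 2 * cB z * m z n * F.C z i j k
      + cA z * dot_deriv n (\<lambda>z. F.C z i j k) z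
      + (- \<beta> z * cD z / (F z)\<^sup>2 * m z n - cB z * F.l z n / F z)
        * (F.h z i j * m z k + F.h z i k * m z j + F.h z j k * m z i)
      + cB z * ((2 * F.C z i j n - (F.h z i n * F.l z j + F.h z j n * F.l z i) / F z) * m z k
        + F.h z i j * (- (\<beta> z / (F z)\<^sup>2 * F.h z k n) - m z n * F.l z k / F z)
        + (2 * F.C z i k n - (F.h z i n * F.l z k + F.h z k n * F.l z i) / F z) * m z j
        + F.h z i k * (- (\<beta> z / (F z)\<^sup>2 * F.h z j n) - m z n * F.l z j / F z)
        + (2 * F.C z j k n - (F.h z j n * F.l z k + F.h z k n * F.l z j) / F z) * m z i
        + F.h z j k * (- (\<beta> z / (F z)\<^sup>2 * F.h z i n) - m z n * F.l z i / F z))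
      + (cE z * m z n - cD z * F.l z n / F z) * (m z i * m z j * m z k)
      + cD z * ((- (\<beta> z / (F z)\<^sup>2 * F.h z i n) - m z n * F.l z i / F z) * m z j * m z k
        + m z i * (- (\<beta> z / (F z)\<^sup>2 * F.h z j n) - m z n * F.l z j / F z) * m z k
        + m z i * m z j * (- (\<beta> z / (F z)\<^sup>2 * F.h z k n) - m z n * F.l z k / F z))"
    (is "_ = ?rhs")
proof (rule dot_deriv_eqI)
  note h = F.has_dot_deriv_ang_metric[OF z, of n] and m = deriv_m[OF z, of n]
  have "has_dot_deriv n (\<lambda>z. cA z * F.C z i j k
    + cB z * (F.h z i j * m z k + F.h z i k * m z j + F.h z j k * m z i)
    + cD z * (m z i * m z j * m z k)) ?rhs z"
    by (rule DERIV_cong[OF DERIV_add[OF DERIV_add[OF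
        DERIV_mult[OF deriv_cA[OF z, of n] F.has_dot_deriv_cartan[OF z, of n i j k]]
        DERIV_mult[OF deriv_cB[OF z, of n] DERIV_add[OF DERIV_add[OF
          DERIV_mult[OF h[of i j] m[of k]] DERIV_mult[OF h[of i k] m[of j]]]
          DERIV_mult[OF h[of j k] m[of i]]]]]
        DERIV_mult[OF deriv_cD[OF z, of n] DERIV_mult[OF DERIV_mult[OF m[of i] m[of j]] m[of k]]]]])
      (simp only: scaleR_zero_left add_0_right, simp only: algebra_simps)
  then show "has_dot_deriv n (\<lambda>z. Fb.C z i j k) ?rhs z"
    by (rule F.slit_cong[rotated 2]) (use z cartan_Fb in auto)
qed

section \<open>The inverse metric of the changed norm\<close>

text \<open>The barred angular metric \<open>A h + q\<^sub>0 m m\<close> sends the raised \<open>m\<close> to \<open>(A + m\<^sup>2 q\<^sub>0) m\<close>, so \<open>den\<close> is its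
eigenvalue, relative to \<open>h\<close>, in the direction of \<open>m\<close>.\<close>

definition msq where "msq z = F.ip z (m z) (m z)"
definition den where "den z = cA z + msq z * cq z"
definition s0 where "s0 z = cq z / (cA z * den z)"

text \<open>The Sherman-Morrison formula for the rank-one perturbation \<open>A h + q\<^sub>0 m m\<close>. The further summand
\<open>l l\<close> of the barred metric (with barred \<open>l\<close>) is compensated by a multiple of \<open>z\<close>, because the barred
metric sends \<open>z\<close> to \<open>Fb\<close> times the barred \<open>l\<close>.\<close>

lemma raise_Fb:
  assumes z: "z \<noteq> 0" and A: "cA z \<noteq> 0" and den: "den z \<noteq> 0"
    and v: "(\<Sum>i\<in>UNIV. v i * z $ i) = 0"
  shows "Fb.raise z v i = F.raise z v i / cA z - s0 z * F.ip z (m z) v * F.raise z (m z) i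
    - (f2 z * (F.ip z (m z) v / den z) / Fb z) * z $ i"
proof (rule Fb.raise_unique[OF z])
  fix i
  let ?c = "F.ip z (m z) v"
  define w where "w j = F.raise z v j / cA z - s0 z * ?c * F.raise z (m z) j" for j
  have h_raise: "(\<Sum>j\<in>UNIV. F.h z i j * F.raise z u j) = u i"
    if "(\<Sum>i\<in>UNIV. u i * z $ i) = 0" for u
    using F.ip_ang_metric[OF z that, of i] by (simp add: F.ip_def F.ang_metric_sym[OF z, of i])
  have l_raise: "(\<Sum>j\<in>UNIV. F.l z j * F.raise z u j) = 0"
    if "(\<Sum>i\<in>UNIV. u i * z $ i) = 0" for u
  proof -
    have "(\<Sum>j\<in>UNIV. F.l z j * F.raise z u j) = F.ip z u (F.l z)"
      by (subst F.ip_commute[OF z]) (simp add: F.ip_def)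
    also have "\<dots> = 0"
      by (simp add: F.ip_def F.raise_supp_form[OF z] that sum_divide_distrib[symmetric])
    finally show ?thesis .
  qed
  have lin: "(\<Sum>j\<in>UNIV. u j * w j) = (\<Sum>j\<in>UNIV. u j * F.raise z v j) / cA z
      - s0 z * ?c * (\<Sum>j\<in>UNIV. u j * F.raise z (m z) j)" for u
    by (simp add: w_def sum_distrib_left sum_divide_distrib sum_subtractf[symmetric] algebra_simps)
  have hw: "(\<Sum>j\<in>UNIV. F.h z i j * w j) = v i / cA z - s0 z * ?c * m z i"
    unfolding lin h_raise[OF v] h_raise[OF euler_m[OF z]] ..
  have "(\<Sum>j\<in>UNIV. m z j * w j) = ?c / cA z - s0 z * ?c * msq z"
    unfolding lin by (simp add: F.ip_def msq_def)
  also have "\<dots> = ?c / den z"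
    using A den by (simp add: s0_def field_simps) (simp add: den_def algebra_simps)
  finally have mw: "(\<Sum>j\<in>UNIV. m z j * w j) = ?c / den z" .
  have lw: "(\<Sum>j\<in>UNIV. Fb.l z j * w j) = f2 z * (?c / den z)"
  proof -
    have "(\<Sum>j\<in>UNIV. Fb.l z j * w j)
        = f2 z * (\<Sum>j\<in>UNIV. m z j * w j) + Fb z / F z * (\<Sum>j\<in>UNIV. F.l z j * w j)"
      by (simp add: supp_form_Fb[OF z] sum_distrib_left sum.distrib[symmetric] algebra_simps)
    then show ?thesis
      unfolding mw lin[of "F.l z"] l_raise[OF v] l_raise[OF euler_m[OF z]] by simp
  qed
  have "(\<Sum>j\<in>UNIV. Fb.g z i j * w j)
      = cA z * (\<Sum>j\<in>UNIV. F.h z i j * w j) + cq z * m z i * (\<Sum>j\<in>UNIV. m z j * w j)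
        + Fb.l z i * (\<Sum>j\<in>UNIV. Fb.l z j * w j)"
  proof -
    have g: "Fb.g z i j = cA z * F.h z i j + cq z * m z i * m z j + Fb.l z i * Fb.l z j" for j
      using ang_metric_Fb[OF z, of i j] by (simp add: ang_metric_def)
    show ?thesis
      by (simp add: g sum_distrib_left sum.distrib[symmetric] algebra_simps)
  qed
  also have "\<dots> = v i + Fb.l z i * (f2 z * (?c / den z))"
    unfolding hw mw lw using A den by (simp add: s0_def field_simps)
  finally have gw: "(\<Sum>j\<in>UNIV. Fb.g z i j * w j) = v i + Fb.l z i * (f2 z * (?c / den z))" .
  have "(\<Sum>j\<in>UNIV. Fb.g z i j * (w j - (f2 z * (?c / den z) / Fb z) * z $ j))
      = (\<Sum>j\<in>UNIV. Fb.g z i j * w j) - (f2 z * (?c / den z) / Fb z) * (\<Sum>j\<in>UNIV. Fb.g z i j * z $ j)"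
    unfolding right_diff_distrib sum_subtractf sum_distrib_left by (simp only: mult.left_commute)
  also have "\<dots> = v i"
    unfolding gw Fb.euler_fund_tensor[OF z] using Fb.F_nonzero[OF z] by simp
  finally show "(\<Sum>j\<in>UNIV. Fb.g z i j * (F.raise z v j / cA z - s0 z * ?c * F.raise z (m z) j
      - (f2 z * (?c / den z) / Fb z) * z $ j)) = v i"
    by (simp add: w_def)
qed

lemma ip_Fb:
  assumes z: "z \<noteq> 0" and A: "cA z \<noteq> 0" and den: "den z \<noteq> 0"
    and u: "(\<Sum>i\<in>UNIV. u i * z $ i) = 0" and v: "(\<Sum>i\<in>UNIV. v i * z $ i) = 0"
  shows "Fb.ip z u v = F.ip z u v / cA z - s0 z * F.ip z u (m z) * F.ip z v (m z)"
proof -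
  define c a where "c = F.ip z (m z) v" and "a = f2 z * (c / den z) / Fb z"
  have "Fb.ip z u v = (\<Sum>i\<in>UNIV. u i * (F.raise z v i / cA z
      - s0 z * c * F.raise z (m z) i - a * z $ i))"
    by (simp add: Fb.ip_def raise_Fb[OF z A den v] c_def a_def)
  also have "\<dots> = (\<Sum>i\<in>UNIV. u i * F.raise z v i) / cA z
      - s0 z * c * (\<Sum>i\<in>UNIV. u i * F.raise z (m z) i) - a * (\<Sum>i\<in>UNIV. u i * z $ i)"
    by (simp add: sum_distrib_left sum_divide_distrib sum_subtractf[symmetric] algebra_simps)
  finally show ?thesis
    by (simp add: u c_def F.ip_def[symmetric] F.ip_commute[OF z, of "m z" v])
qed

abbreviation Cm where "Cm z i j \<equiv> F.ip z (\<lambda>r. F.C z r i j) (m z)"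
abbreviation CC where "CC z i j k n \<equiv> F.ip z (\<lambda>r. F.C z r i j) (\<lambda>r. F.C z r k n)"

text \<open>Contraction with \<open>h\<close> is the identity on covectors that annihilate \<open>z\<close>. All such contractions with
the barred Cartan tensor are obtained from this lemma, with \<open>v\<close> first the second barred Cartan
tensor, then its constituents \<open>C\<close> and \<open>m\<close>.\<close>

lemma ip_cartan_Fb:
  assumes z: "z \<noteq> 0" and v: "(\<Sum>i\<in>UNIV. v i * z $ i) = 0"
  shows "F.ip z (\<lambda>r. Fb.C z r i j) v = cA z * F.ip z (\<lambda>r. F.C z r i j) v
    + cB z * (v i * m z j + v j * m z i + F.h z i j * F.ip z (m z) v)
    + cD z * (m z i * m z j * F.ip z (m z) v)"
proof -
  have "Fb.C z r i j = cA z * F.C z r i j + (cB z * m z j) * F.h z r i + (cB z * m z i) * F.h z r j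
      + (cB z * F.h z i j + cD z * m z i * m z j) * m z r" for r
    unfolding cartan_Fb[OF z] by (simp add: algebra_simps)
  then show ?thesis
    by (simp only: F.ip_add_left F.ip_scale_left F.ip_ang_metric[OF z v]) (simp add: algebra_simps)
qed

lemma ip_cartan_Fb_m:
  assumes z: "z \<noteq> 0"
  shows "F.ip z (\<lambda>r. Fb.C z r i j) (m z) = cA z * Cm z i j
    + cB z * (2 * m z i * m z j + F.h z i j * msq z) + cD z * msq z * m z i * m z j"
  unfolding ip_cartan_Fb[OF z euler_m[OF z]] msq_def[symmetric] by (simp add: algebra_simps)

lemma ip_cartan_Fb_Fb:
  assumes z: "z \<noteq> 0"
  shows "F.ip z (\<lambda>r. Fb.C z r i j) (\<lambda>r. Fb.C z r k n) =
      cA z * (cA z * CC z i j k n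
        + cB z * (F.h z k n * Cm z i j + F.h z i j * Cm z k n
          + F.C z i k n * m z j + F.C z j k n * m z i + F.C z k i j * m z n + F.C z n i j * m z k)
        + cD z * (m z k * m z n * Cm z i j + m z i * m z j * Cm z k n))
      + (cB z)\<^sup>2 * (F.h z i j * F.h z k n * msq z + 2 * F.h z i j * m z k * m z n
          + 2 * F.h z k n * m z i * m z j
          + F.h z i k * m z j * m z n + F.h z i n * m z j * m z k
          + F.h z j k * m z i * m z n + F.h z j n * m z i * m z k)
      + cB z * cD z * (msq z * (F.h z i j * m z k * m z n + F.h z k n * m z i * m z j)
          + 4 * m z i * m z j * m z k * m z n)
      + (cD z)\<^sup>2 * msq z * m z i * m z j * m z k * m z n"
proof -
  have C0: "(\<Sum>r\<in>UNIV. F.C z r i j * z $ r) = 0" for i j by (rule F.euler_cartan[OF z])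
  have Cb0: "(\<Sum>r\<in>UNIV. Fb.C z r i j * z $ r) = 0" for i j by (rule Fb.euler_cartan[OF z])
  have mC: "F.ip z (m z) (\<lambda>r. Fb.C z r k n) = F.ip z (\<lambda>r. Fb.C z r k n) (m z)"
    and CCb: "F.ip z (\<lambda>r. F.C z r i j) (\<lambda>r. Fb.C z r k n) = F.ip z (\<lambda>r. Fb.C z r k n) (\<lambda>r. F.C z r i j)"
    and Cmc: "F.ip z (m z) (\<lambda>r. F.C z r i j) = Cm z i j"
    and CCc: "F.ip z (\<lambda>r. F.C z r k n) (\<lambda>r. F.C z r i j) = CC z i j k n"
    by (rule F.ip_commute[OF z])+
  show ?thesis
    unfolding ip_cartan_Fb[OF z Cb0] CCb mC
    unfolding ip_cartan_Fb[OF z C0] ip_cartan_Fb_m[OF z] Cmc CCc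
    unfolding cartan_Fb[OF z]
    by (simp add: algebra_simps power2_eq_square)
qed

section \<open>The T-tensor of the changed norm\<close>

text \<open>The theorem on one fibre. The constants \<open>K1\<close> to \<open>K5\<close> are those of the theorem after substitution of
\<open>e\<^sup>\<sigma> p = A\<close>, \<open>e\<^sup>\<sigma> p\<^sub>-\<^sub>1 = 2 B\<close> and \<open>p\<^sub>0\<^sub>2 = 2 D\<close>, which absorbs every factor \<open>e\<^sup>\<sigma>\<close>.\<close>

lemma T_tensor_Fb:
  fixes l i j k :: 'n and K1 K2 K3 K4 K5 :: real and nn nd M \<nu> :: "'n \<Rightarrow> 'n \<Rightarrow> real"
  assumes z: "z \<noteq> 0" and A: "cA z \<noteq> 0" and den: "den z \<noteq> 0"
    and K1: "K1 = (cB z)\<^sup>2 / cA z - 2 * s0 z * (cB z)\<^sup>2 * msq z + cB z * cD z * msq z / den z"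
    and K2: "K2 = cB z - s0 z * cA z * cB z * msq z"
    and K3: "K3 = (cB z)\<^sup>2 * msq z / (2 * den z)"
    and K4: "K4 = cA z * cD z / den z - 2 * s0 z * cA z * cB z"
    and K5: "K5 = 4 * s0 z * (cB z)\<^sup>2 - (4 * cB z * cD z + (cD z)\<^sup>2 * msq z) / den z"
    and nn: "\<And>i j. nn i j = F.l z i * m z j + F.l z j * m z i"
    and nd: "\<And>i j. nd i j = Fb.l z i * m z j + Fb.l z j * m z i"
    and M: "\<And>i j. M i j = K2 * F.h z i j + K4 * m z i * m z j"
    and \<nu>: "\<And>i j. \<nu> i j = cB z * nd i j
      - Fb z * (K1 + 3 * (cB z)\<^sup>2 / cA z + \<beta> z * cD z / (F z)\<^sup>2) * m z i * m z j
      - Fb z * cB z / F z * nn i j"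
  shows "T_tensor Fb z l i j k =
      cA z * Fb z / F z * T_tensor F z l i j k
      - Fb z * (\<beta> z * cB z / (F z)\<^sup>2 + 2 * K3)
        * (F.h z l i * F.h z j k + F.h z l j * F.h z i k + F.h z l k * F.h z i j)
      + (F.h z l i * \<nu> j k + F.h z l j * \<nu> i k + F.h z i j * \<nu> l k
        + F.h z j k * \<nu> i l + F.h z l k * \<nu> i j + F.h z i k * \<nu> j l)
      + (cA z * f2 z - Fb z * cB z)
        * (F.C z l i j * m z k + F.C z i j k * m z l + F.C z j l k * m z i + F.C z l i k * m z j)
      - Fb z * (M i j * Cm z l k + M j l * Cm z i k + M i l * Cm z j k
        + M l k * Cm z i j + M j k * Cm z i l + M i k * Cm z j l)
      + Fb z * s0 z * (cA z)\<^sup>2 * (Cm z i j * Cm z l k + Cm z l j * Cm z i k + Cm z i l * Cm z j k)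
      + Fb z * (3 * K5 + cE z) * m z l * m z i * m z j * m z k
      - Fb z * cD z / F z * (nn i j * m z k * m z l + nn l k * m z i * m z j)
      + cD z * (nd i j * m z k * m z l + nd l k * m z i * m z j)"
proof -
  let ?X = "\<lambda>i j. F.ip z (\<lambda>r. Fb.C z r i j) (m z)"
  let ?Q = "\<lambda>i j k n. Fb.ip z (\<lambda>r. Fb.C z r i j) (\<lambda>r. Fb.C z r k n)"
  have C0: "(\<Sum>r\<in>UNIV. Fb.C z r i j * z $ r) = 0" for i j by (rule Fb.euler_cartan[OF z])
  \<comment> \<open>Both expressions involving \<open>den\<close> become polynomial in \<open>s0\<close> and the inverse of \<open>cA\<close>.\<close>
  have iw: "inverse (den z) = inverse (cA z) - s0 z * msq z"
    using A den by (simp add: s0_def field_simps) (simp add: den_def algebra_simps)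
  have A_iw: "cA z / den z = 1 - cA z * s0 z * msq z"
    using A unfolding divide_inverse iw by (simp add: algebra_simps)
  have split: "(cA z * P + S1 + S2 + S3) / cA z = P + inverse (cA z) * (S1 + S2 + S3)"
    for P S1 S2 S3
    using A by (simp add: field_simps)
  have Q: "?Q i j k n = cA z * CC z i j k n
        + cB z * (F.h z k n * Cm z i j + F.h z i j * Cm z k n + F.C z i k n * m z j + F.C z j k n * m z i
          + F.C z k i j * m z n + F.C z n i j * m z k)
        + cD z * (m z k * m z n * Cm z i j + m z i * m z j * Cm z k n)
        + inverse (cA z) * ((cB z)\<^sup>2 * (F.h z i j * F.h z k n * msq z
            + 2 * F.h z i j * m z k * m z n + 2 * F.h z k n * m z i * m z j
            + F.h z i k * m z j * m z n + F.h z i n * m z j * m z k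
            + F.h z j k * m z i * m z n + F.h z j n * m z i * m z k)
          + cB z * cD z * (msq z * (F.h z i j * m z k * m z n + F.h z k n * m z i * m z j)
            + 4 * m z i * m z j * m z k * m z n)
          + (cD z)\<^sup>2 * msq z * m z i * m z j * m z k * m z n)
        - s0 z * ?X i j * ?X k n" for i j k n
    unfolding ip_Fb[OF z A den C0 C0] ip_cartan_Fb_Fb[OF z] split ..
  have lb: "Fb.l z i = f2 z * m z i + Fb z * inverse (F z) * F.l z i" for i
    by (simp add: supp_form_Fb[OF z] divide_inverse)
  have sym: "F.C z i j k = F.C z j i k" "F.C z i j k = F.C z i k j" "Cm z i j = Cm z j i" for i j k
    using F.cartan_sym[OF z] by metis+
  have dC: "dot_deriv k (\<lambda>z. Fb.C z l i j) z = 2 * cB z * m z k * F.C z l i j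
      + cA z * dot_deriv k (\<lambda>z. F.C z l i j) z
      + (- \<beta> z * cD z * (inverse (F z))\<^sup>2 * m z k - cB z * F.l z k * inverse (F z))
        * (F.h z l i * m z j + F.h z l j * m z i + F.h z i j * m z l)
      + cB z * ((2 * F.C z l i k - (F.h z l k * F.l z i + F.h z i k * F.l z l) * inverse (F z)) * m z j
        + F.h z l i * (- (\<beta> z * (inverse (F z))\<^sup>2 * F.h z j k) - m z k * F.l z j * inverse (F z))
        + (2 * F.C z l j k - (F.h z l k * F.l z j + F.h z j k * F.l z l) * inverse (F z)) * m z i
        + F.h z l j * (- (\<beta> z * (inverse (F z))\<^sup>2 * F.h z i k) - m z k * F.l z i * inverse (F z))
        + (2 * F.C z i j k - (F.h z i k * F.l z j + F.h z j k * F.l z i) * inverse (F z)) * m z l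
        + F.h z i j * (- (\<beta> z * (inverse (F z))\<^sup>2 * F.h z l k) - m z k * F.l z l * inverse (F z)))
      + (cE z * m z k - cD z * F.l z k * inverse (F z)) * (m z l * m z i * m z j)
      + cD z * ((- (\<beta> z * (inverse (F z))\<^sup>2 * F.h z l k) - m z k * F.l z l * inverse (F z)) * m z i * m z j
        + m z l * (- (\<beta> z * (inverse (F z))\<^sup>2 * F.h z i k) - m z k * F.l z i * inverse (F z)) * m z j
        + m z l * m z i * (- (\<beta> z * (inverse (F z))\<^sup>2 * F.h z j k) - m z k * F.l z j * inverse (F z)))"
    unfolding dot_deriv_cartan_Fb[OF z] divide_inverse power_inverse ..
  have \<nu>': "\<nu> i j = cB z * nd i j - Fb z * ((cB z)\<^sup>2 * inverse (cA z) - 2 * (cB z)\<^sup>2 * s0 z * msq z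
      + cB z * cD z * msq z * inverse (den z) + 3 * ((cB z)\<^sup>2 * inverse (cA z))
      + \<beta> z * cD z * (inverse (F z))\<^sup>2) * m z i * m z j - Fb z * cB z * inverse (F z) * nn i j" for i j
    unfolding \<nu> K1 divide_inverse power_inverse by (simp add: mult_ac)
  have M': "M i j = (cB z - cA z * cB z * s0 z * msq z) * F.h z i j
      + (cA z / den z * cD z - 2 * cA z * cB z * s0 z) * m z i * m z j" for i j
    unfolding M K2 K4 by (simp add: mult_ac)
  have T: "cA z * Fb z / F z * T_tensor F z l i j k =
      cA z * Fb z * (dot_deriv k (\<lambda>z. F.C z l i j) z - CC z i j l k - CC z l j i k - CC z l i j k)
      + cA z * Fb z * inverse (F z) * (F.C z l i j * F.l z k + F.C z l i k * F.l z j
        + F.C z l j k * F.l z i + F.C z i j k * F.l z l)"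
    unfolding F.T_tensor_eq[OF z] using F.F_nonzero[OF z] by (simp add: divide_inverse distrib_left)
  have K3': "\<beta> z * cB z / (F z)\<^sup>2 + 2 * K3
      = \<beta> z * cB z * (inverse (F z))\<^sup>2 + (cB z)\<^sup>2 * msq z * inverse (den z)"
    unfolding K3 divide_inverse power_inverse by simp
  have K5': "3 * K5 + cE z = 3 * (4 * s0 z * (cB z)\<^sup>2
      - (4 * cB z * cD z + (cD z)\<^sup>2 * msq z) * inverse (den z)) + cE z"
    unfolding K5 divide_inverse ..
  show ?thesis
    unfolding Fb.T_tensor_eq[OF z] T K3' K5'
    unfolding divide_inverse[of _ "F z"]
    by (rule T_tensor_algebra[OF F.ang_metric_sym[OF z] sym iw A_iw lb cartan_Fb[OF z]
        ip_cartan_Fb_m[OF z] Q dC nn nd M' \<nu>'])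
qed

end

section \<open>Passage from the manifold to a fibre\<close>

text \<open>Smoothness in all coordinates \<open>(x, y)\<close> restricts to smoothness in \<open>y\<close> alone.\<close>

lemma minkowski_norm_fibre:
  assumes "finsler_space A L" "c \<in> A" "x \<in> chart_image c"
  shows "minkowski_norm (local_rep A c L x)"
proof
  have "smooth_on (chart_image c \<times> (UNIV - {0})) (\<lambda>(x, y). local_rep A c L x y)"
    using assms(1,2) unfolding finsler_space_def by blast
  from smooth_on_slice[OF _ assms(3) this]
  show "smooth_on (UNIV - {0}) (local_rep A c L x)"
    by (simp add: open_delete)
qed (use assms in \<open>auto simp: finsler_space_def\<close>)

lemma has_derivative_partial2:
  assumes "smooth_on D (\<lambda>(u, v). \<phi> u v)" "(u, v) \<in> D"
  shows "((\<lambda>s. \<phi> u s) has_real_derivative partial2 \<phi> u v) (at v)"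
proof -
  have "((\<lambda>t. \<phi> u (v + t)) has_real_derivative partial2 \<phi> u v) (at 0)"
    using DERIV_along_line[OF assms(1), of "(u, v)" 0 "(0, 1)"] assms(2)
    by (simp add: partial2_eq_dir_deriv[OF assms])
  then show ?thesis
    using DERIV_shift[of "\<lambda>s. \<phi> u s" _ 0 v] by (simp add: add.commute)
qed

text \<open>Identifies \<open>f\<^sub>1\<^sub>2\<close>, which enters \<open>p\<^sub>-\<^sub>1\<close>, with the derivative that Euler's relation for \<open>f\<^sub>2\<close> controls.\<close>

lemma partial_commute:
  assumes D: "open D" and \<phi>: "smooth_on D (\<lambda>(u, v). \<phi> u v)" and uv: "(u, v) \<in> D"
  shows "partial2 (partial1 \<phi>) u v = partial1 (partial2 \<phi>) u v"
proof -
  have "partial2 (partial1 \<phi>) u v = dir_deriv (0, 1) (dir_deriv (1, 0) (\<lambda>(u, v). \<phi> u v)) (u, v)"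
    unfolding partial2_eq_dir_deriv[OF smooth_on_partial1[OF D \<phi>] uv]
    by (rule dir_deriv_cong[OF D _ smooth_on_partial1[OF D \<phi>] uv])
      (auto simp: partial1_eq_dir_deriv[OF \<phi>])
  moreover have "partial1 (partial2 \<phi>) u v = dir_deriv (1, 0) (dir_deriv (0, 1) (\<lambda>(u, v). \<phi> u v)) (u, v)"
    unfolding partial1_eq_dir_deriv[OF smooth_on_partial2[OF D \<phi>] uv]
    by (rule dir_deriv_cong[OF D _ smooth_on_partial2[OF D \<phi>] uv])
      (auto simp: partial2_eq_dir_deriv[OF \<phi>])
  ultimately show ?thesis
    using dir_deriv_commute[OF \<phi> D uv] by simp
qed

lemma has_derivative_partial2_cong:
  assumes "open D" "(u, v) \<in> D" "\<And>s. (u, s) \<in> D \<Longrightarrow> G s = H s"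
    "(G has_real_derivative d) (at v)"
  shows "(H has_real_derivative d) (at v)"
proof (rule has_field_derivative_transform_within_open[OF assms(4)])
  show "open (Pair u -` D)"
    by (rule open_vimage[OF assms(1)]) (intro continuous_intros)
qed (use assms(2,3) in auto)

theorem theorem3p1:
  fixes X :: "'a topology"
    and A :: "('a, 'n::finite) chart set"
    and L \<beta> Lbar :: "'a \<Rightarrow> ('a, 'n) tvec \<Rightarrow> real"
    and \<sigma> :: "'a \<Rightarrow> real"
    and D :: "(real \<times> real) set"
    and f p0 :: "real \<Rightarrow> real \<Rightarrow> real"
    and c :: "('a, 'n) chart"
    and x y :: "real ^ 'n"
    and F Fb :: "real ^ 'n \<Rightarrow> real"
    and Lv Lbv Lt bt es f1 f2 f12 f22 p q0 pm1 p02 p022 msq s0 K1 K2 K3 K4 K5 :: real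
    and b yl m bup ell ellb :: "'n \<Rightarrow> real"
    and g ginv h Cb nn nd M \<nu> :: "'n \<Rightarrow> 'n \<Rightarrow> real"
    and C :: "'n \<Rightarrow> 'n \<Rightarrow> 'n \<Rightarrow> real"
    and T Tb :: "'n \<Rightarrow> 'n \<Rightarrow> 'n \<Rightarrow> 'n \<Rightarrow> real"
  assumes manifold: "smooth_manifold X A"
    and finsler: "finsler_space A L"
    and sigma: "smooth_function A \<sigma>"
    and beta: "one_form A \<beta>"
    and f_hom: "homogeneous_function D f"
    and f_dom: "\<And>c x y. c \<in> A \<Longrightarrow> x \<in> chart_image c \<Longrightarrow> y \<noteq> 0 \<Longrightarrow>
        (exp (\<sigma> (chart_inv c x)) * local_rep A c L x y, local_rep A c \<beta> x y) \<in> D"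
    and Lbar: "Lbar = gen_beta_change f \<sigma> \<beta> L"
    and finsler_bar: "finsler_space A Lbar"
    and point: "c \<in> A" "x \<in> chart_image c" "y \<noteq> 0"
    and F: "F = local_rep A c L x"
    and Fb: "Fb = local_rep A c Lbar x"
    and Lv: "Lv = F y"
    and Lbv: "Lbv = Fb y"
    and es: "es = exp (\<sigma> (chart_inv c x))"
    and Lt: "Lt = es * Lv"
    and bt: "bt = local_rep A c \<beta> x y"
    and b: "b = (\<lambda>i. local_rep A c \<beta> x (axis i 1))"
    and g: "g = fund_tensor F y"
    and ginv: "ginv = fund_inv F y"
    and ell: "ell = supp_form F y"
    and ellb: "ellb = supp_form Fb y"
    and yl: "yl = (\<lambda>i. \<Sum>j\<in>UNIV. g i j * y $ j)"
    and h: "h = ang_metric F y"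
    and C: "C = cartan F y"
    and T: "T = T_tensor F y"
    and Tb: "Tb = T_tensor Fb y"
    and f1: "f1 = partial1 f Lt bt"
    and f2: "f2 = partial2 f Lt bt"
    and f12: "f12 = partial2 (partial1 f) Lt bt"
    and f22: "f22 = partial2 (partial2 f) Lt bt"
    and p: "p = f Lt bt * f1 / Lv"
    and q0: "q0 = f Lt bt * f22"
    and p0: "p0 = (\<lambda>u v. (partial2 f u v)\<^sup>2 + f u v * partial2 (partial2 f) u v)"
    and pm1: "pm1 = f Lt bt * f12 / Lv + p * f2 / f Lt bt"
    and p02: "p02 = partial2 p0 Lt bt"
    and p022: "p022 = partial2 (partial2 p0) Lt bt"
    and m: "m = (\<lambda>i. b i - bt / Lv\<^sup>2 * yl i)"
    and msq: "msq = (\<Sum>i\<in>UNIV. \<Sum>j\<in>UNIV. ginv i j * m i * m j)"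
    and bup: "bup = (\<lambda>i. \<Sum>j\<in>UNIV. ginv i j * b j)"
    and Cb: "Cb = (\<lambda>i j. \<Sum>r\<in>UNIV. C i j r * bup r)"
    and s0: "s0 = inverse es * q0 / (p * (es * p + msq * q0))"
    and K1: "K1 = es\<^sup>2 * pm1\<^sup>2 / (4 * p) * (inverse es - 2 * s0 * p * msq)
                + es * pm1 * p02 * msq / (4 * (es * p + q0 * msq))"
    and K2: "K2 = es * pm1 / 2 - 1 / 2 * es\<^sup>2 * s0 * p * pm1 * msq"
    and K3: "K3 = es\<^sup>2 * pm1\<^sup>2 * msq / (8 * (es * p + q0 * msq))"
    and K4: "K4 = es * p * p02 / (2 * (es * p + q0 * msq)) - es\<^sup>2 * s0 * p * pm1"
    and K5: "K5 = es\<^sup>2 * s0 * pm1\<^sup>2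
                - (4 * es * pm1 * p02 + p02\<^sup>2 * msq) / (4 * (es * p + q0 * msq))"
    and nn: "nn = (\<lambda>i j. ell i * m j + ell j * m i)"
    and nd: "nd = (\<lambda>i j. ellb i * m j + ellb j * m i)"
    and M: "M = (\<lambda>i j. K2 * h i j + K4 * m i * m j)"
    and \<nu>: "\<nu> = (\<lambda>i j. 1 / 2 * es * pm1 * nd i j
                - Lbv * (K1 + 3 * es * pm1\<^sup>2 / (4 * p) + bt * p02 / (2 * Lv\<^sup>2)) * m i * m j
                - Lbv * es * pm1 / (2 * Lv) * nn i j)"
    and m_nz: "\<exists>i. m i \<noteq> 0"
    and msq_nz: "msq \<noteq> 0"
    and p_nz: "p \<noteq> 0"
    and den_nz: "es * p + msq * q0 \<noteq> 0"
  shows "\<forall>l i j k. Tb l i j k =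
      es * p * Lbv / Lv * T l i j k
      - Lbv * (bt * es * pm1 / (2 * Lv\<^sup>2) + 2 * K3)
          * (h l i * h j k + h l j * h i k + h l k * h i j)
      + (h l i * \<nu> j k + h l j * \<nu> i k + h i j * \<nu> l k
          + h j k * \<nu> i l + h l k * \<nu> i j + h i k * \<nu> j l)
      + (es * p * f2 - 1 / 2 * es * Lbv * pm1)
          * (C l i j * m k + C i j k * m l + C j l k * m i + C l i k * m j)
      - Lbv * (M i j * Cb l k + M j l * Cb i k + M i l * Cb j k
          + M l k * Cb i j + M j k * Cb i l + M i k * Cb j l)
      + Lbv * es\<^sup>2 * s0 * p\<^sup>2 * (Cb i j * Cb l k + Cb l j * Cb i k + Cb i l * Cb j k)
      + 1 / 2 * Lbv * (6 * K5 + p022) * m l * m i * m j * m k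
      - Lbv * p02 / (2 * Lv) * (nn i j * m k * m l + nn l k * m i * m j)
      + 1 / 2 * p02 * (nd i j * m k * m l + nd l k * m i * m j)"
proof (intro allI)
  fix l i j k
  interpret F: minkowski_norm F
    unfolding F by (rule minkowski_norm_fibre[OF finsler point(1,2)])
  interpret Fb: minkowski_norm Fb
    unfolding Fb by (rule minkowski_norm_fibre[OF finsler_bar point(1,2)])
  have hom: "euler_homogeneous D 1 f"
    by (rule homogeneous_function_euler[OF f_hom])
  interpret bc: beta_change F Fb f D es "local_rep A c \<beta> x"
  proof (intro beta_change.intro beta_change_axioms.intro
      F.minkowski_norm_axioms Fb.minkowski_norm_axioms)
    show "euler_homogeneous D 1 f" by (rule hom)
    show "es > 0" by (simp add: es)
    show "linear (local_rep A c \<beta> x)"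
      using beta point unfolding one_form_def by blast
    show "(es * F z, local_rep A c \<beta> x z) \<in> D" if "z \<noteq> 0" for z
      using f_dom[OF point(1,2) that] by (simp add: es F)
    show "Fb z = f (es * F z) (local_rep A c \<beta> x z)" for z
      by (simp add: Fb F es Lbar local_rep_def gen_beta_change_def)
  qed
  note z = point(3)
  have es_nz: "es \<noteq> 0" and Lv_nz: "Lv \<noteq> 0" and Lbv_nz: "Lbv \<noteq> 0"
    using F.F_nonzero[OF z] Fb.F_nonzero[OF z] by (simp_all add: es Lv Lbv)
  have D: "open D" and smooth: "smooth_on D (\<lambda>(u, v). f u v)"
    using hom unfolding euler_homogeneous_def by blast+
  have uv: "(Lt, bt) \<in> D"
    using bc.in_D[OF z] by (simp add: Lt Lv bt)
  have f_val: "f Lt bt = Lbv"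
    by (simp add: Lbv bc.Fb_eq Lt Lv bt)
  have pull: "bc.pull \<phi> y = \<phi> Lt bt" for \<phi>
    by (simp add: bc.pull_def Lt Lv bt)

  \<comment> \<open>Euler's relations for \<open>f\<close> and \<open>f\<^sub>2\<close> express \<open>f\<^sub>1\<close> and \<open>f\<^sub>1\<^sub>2\<close>, and with them \<open>p\<close> and \<open>p\<^sub>-\<^sub>1\<close>,
    by derivatives in \<open>\<beta>\<close> alone.\<close>
  have "Lt * f1 + bt * f2 = f Lt bt"
    using hom uv unfolding euler_homogeneous_def f1 f2 by simp
  then have euler_f: "Lbv - bt * f2 = es * Lv * f1"
    by (simp only: f_val) (simp add: Lt)
  have "Lt * partial1 (partial2 f) Lt bt + bt * f22 = 0"
    using bc.hom2 uv unfolding euler_homogeneous_def f22 by simp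
  then have euler_f2: "bt * f22 = - (es * Lv * f12)"
    unfolding f12 partial_commute[OF D smooth uv] by (simp add: Lt)

  have p0_deriv: "partial2 p0 u v = 3 * partial2 f u v * partial2 (partial2 f) u v
      + f u v * partial2 (partial2 (partial2 f)) u v" if "(u, v) \<in> D" for u v
  proof -
    note d = has_derivative_partial2[OF _ that]
    have s2: "smooth_on D (\<lambda>(u, v). partial2 f u v)"
      by (rule smooth_on_partial2[OF D smooth])
    show ?thesis
      unfolding p0 partial2_def[of "\<lambda>u v. (partial2 f u v)\<^sup>2 + f u v * partial2 (partial2 f) u v"]
      by (rule DERIV_imp_deriv, rule DERIV_cong[OF DERIV_add[OF DERIV_power[OF d[OF s2], of 2]
          DERIV_mult[OF d[OF smooth] d[OF smooth_on_partial2[OF D s2]]]]])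
        (simp add: algebra_simps)
  qed
  have p02_val: "p02 = 2 * bc.cD y"
    unfolding p02 p0_deriv[OF uv] by (simp add: bc.cD_def pull f_val Lbv)
  have p022_val: "p022 = 2 * bc.cE y"
  proof -
    note d = has_derivative_partial2[OF _ uv]
    note s2 = smooth_on_partial2[OF D smooth]
    note s22 = smooth_on_partial2[OF D s2]
    note s222 = smooth_on_partial2[OF D s22]
    have "((\<lambda>s. partial2 p0 Lt s) has_real_derivative 2 * bc.cE y) (at bt)"
    proof (rule has_derivative_partial2_cong[OF D uv])
      show "((\<lambda>s. 3 * partial2 f Lt s * partial2 (partial2 f) Lt s
          + f Lt s * partial2 (partial2 (partial2 f)) Lt s) has_real_derivative 2 * bc.cE y) (at bt)"
        by (rule DERIV_cong[OF DERIV_add[OF DERIV_mult[OF DERIV_cmult[OF d[OF s2], of 3] d[OF s22]]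
            DERIV_mult[OF d[OF smooth] d[OF s222]]]])
          (simp add: bc.cE_def pull f_val[symmetric] Lbv[symmetric] algebra_simps power2_eq_square)
    qed (simp add: p0_deriv)
    then show ?thesis
      unfolding p022 partial2_def[of "partial2 p0"] by (rule DERIV_imp_deriv)
  qed
  have A_val: "es * p = bc.cA y"
    using Lv_nz unfolding bc.cA_def pull p f_val
    by (simp add: Lv[symmetric] Lbv[symmetric] bt[symmetric] f2[symmetric] euler_f power2_eq_square)
  have B_val: "es * pm1 = 2 * bc.cB y"
    using Lv_nz Lbv_nz unfolding bc.cB_def pull pm1 p f_val
    by (simp add: Lv[symmetric] Lbv[symmetric] bt[symmetric] f2[symmetric] f22[symmetric] euler_f
        mult.assoc euler_f2 power2_eq_square field_simps)
  have q_val: "q0 = bc.cq y"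
    unfolding q0 bc.cq_def pull f22 f_val Lbv ..
  have m_val: "m i = bc.m y i" for i
    using Lv_nz unfolding m yl g F.euler_fund_tensor[OF z] bc.m_def b bc.b_def
    by (simp add: Lv[symmetric] bt[symmetric] power2_eq_square)
  have msq_val: "msq = bc.msq y"
    unfolding msq bc.msq_def F.ip_def F.raise_def m_val ginv
    by (simp add: sum_distrib_left mult_ac)
  have den_val: "es * p + msq * q0 = bc.den y" "es * p + q0 * msq = bc.den y"
    unfolding bc.den_def A_val msq_val q_val by simp_all
  have s0_val: "s0 = bc.s0 y"
    unfolding s0 bc.s0_def den_val A_val[symmetric] q_val[symmetric]
    using es_nz by (simp add: divide_inverse mult_ac)
  have Cb_val: "Cb i j = bc.Cm y i j" for i j
  proof -
    \<comment> \<open>The form \<open>b\<close> differs from \<open>m\<close> by a multiple of \<open>l\<close>, which raises to a multiple of \<open>y\<close>.\<close>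
    have bup': "bup r = F.raise y (bc.m y) r + bt / Lv\<^sup>2 * y $ r" for r
    proof -
      have "bup r = F.raise y (bc.m y) r + bt / Lv * F.raise y (supp_form F y) r"
        unfolding bup F.raise_def ginv bc.m_def b bc.b_def
        by (simp add: Lv[symmetric] bt[symmetric] sum_distrib_left sum.distrib[symmetric] algebra_simps)
      then show ?thesis
        by (simp add: F.raise_supp_form[OF z] Lv[symmetric] power2_eq_square)
    qed
    have "Cb i j = (\<Sum>r\<in>UNIV. C r i j * F.raise y (bc.m y) r) + bt / Lv\<^sup>2 * (\<Sum>r\<in>UNIV. C r i j * y $ r)"
    proof -
      have "C i j r = C r i j" for r unfolding C using F.cartan_sym[OF z] by metis
      then show ?thesis
        unfolding Cb bup' by (simp add: sum_distrib_left sum.distrib[symmetric] algebra_simps)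
    qed
    then show ?thesis
      unfolding C F.euler_cartan[OF z] by (simp add: F.ip_def)
  qed
  have A_nz: "bc.cA y \<noteq> 0" using es_nz p_nz by (simp add: A_val[symmetric])
  have den_nz': "bc.den y \<noteq> 0" using den_nz by (simp add: den_val)
  have p_eq: "p = bc.cA y / es" and pm1_eq: "pm1 = 2 * bc.cB y / es"
    using es_nz by (simp_all add: A_val[symmetric] B_val[symmetric])

  have K1_val: "K1 = (bc.cB y)\<^sup>2 / bc.cA y - 2 * bc.s0 y * (bc.cB y)\<^sup>2 * bc.msq y
      + bc.cB y * bc.cD y * bc.msq y / bc.den y"
    unfolding K1 den_val unfolding s0_val msq_val B_val p02_val unfolding p_eq pm1_eq
    using es_nz A_nz den_nz' by (simp add: field_simps power2_eq_square)
  have K2_val: "K2 = bc.cB y - bc.s0 y * bc.cA y * bc.cB y * bc.msq y"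
    unfolding K2 s0_val msq_val B_val unfolding p_eq pm1_eq
    using es_nz by (simp add: field_simps power2_eq_square)
  have K3_val: "K3 = (bc.cB y)\<^sup>2 * bc.msq y / (2 * bc.den y)"
    unfolding K3 den_val unfolding msq_val unfolding pm1_eq
    using es_nz den_nz' by (simp add: field_simps power2_eq_square)
  have K4_val: "K4 = bc.cA y * bc.cD y / bc.den y - 2 * bc.s0 y * bc.cA y * bc.cB y"
    unfolding K4 den_val unfolding s0_val A_val p02_val unfolding p_eq pm1_eq
    using es_nz den_nz' by (simp add: field_simps power2_eq_square)
  have K5_val: "K5 = 4 * bc.s0 y * (bc.cB y)\<^sup>2
      - (4 * bc.cB y * bc.cD y + (bc.cD y)\<^sup>2 * bc.msq y) / bc.den y"
    unfolding K5 den_val unfolding s0_val msq_val p02_val unfolding pm1_eq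
    using es_nz den_nz' by (simp add: field_simps power2_eq_square)

  have nn_val: "nn i j = supp_form F y i * bc.m y j + supp_form F y j * bc.m y i" for i j
    by (simp add: nn ell m_val)
  have nd_val: "nd i j = supp_form Fb y i * bc.m y j + supp_form Fb y j * bc.m y i" for i j
    by (simp add: nd ellb m_val)
  have M_val: "M i j = K2 * ang_metric F y i j + K4 * bc.m y i * bc.m y j" for i j
    by (simp add: M h m_val)
  have \<nu>_val: "\<nu> i j = bc.cB y * nd i j
      - Fb y * (K1 + 3 * (bc.cB y)\<^sup>2 / bc.cA y + local_rep A c \<beta> x y * bc.cD y / (F y)\<^sup>2)
        * bc.m y i * bc.m y j
      - Fb y * bc.cB y / F y * nn i j" for i j
  proof -
    have c: "1 / 2 * es * pm1 = bc.cB y" "Lbv * es * pm1 / (2 * Lv) = Lbv * bc.cB y / Lv"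
      "3 * es * pm1\<^sup>2 / (4 * p) = 3 * (bc.cB y)\<^sup>2 / bc.cA y"
      "bt * p02 / (2 * Lv\<^sup>2) = bt * bc.cD y / Lv\<^sup>2"
      unfolding p02_val p_eq pm1_eq using es_nz by (simp_all add: power2_eq_square)
    show ?thesis
      unfolding \<nu> c unfolding m_val Lv Lbv bt ..
  qed
  have coeff: "bt * es * pm1 / (2 * Lv\<^sup>2) = bt * bc.cB y / Lv\<^sup>2"
    "es * p * f2 - 1 / 2 * es * Lbv * pm1 = bc.cA y * f2 - Lbv * bc.cB y"
    "Lbv * es\<^sup>2 * s0 * p\<^sup>2 = Lbv * bc.s0 y * (bc.cA y)\<^sup>2"
    "1 / 2 * Lbv * (6 * K5 + p022) = Lbv * (3 * K5 + bc.cE y)"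
    "Lbv * p02 / (2 * Lv) = Lbv * bc.cD y / Lv"
    "1 / 2 * p02 = bc.cD y"
    unfolding p02_val p022_val s0_val p_eq pm1_eq using es_nz by (simp_all add: power2_eq_square)
  have f2_val: "f2 = bc.pull (partial2 f) y"
    by (simp add: pull f2)
  show "Tb l i j k =
      es * p * Lbv / Lv * T l i j k
      - Lbv * (bt * es * pm1 / (2 * Lv\<^sup>2) + 2 * K3)
          * (h l i * h j k + h l j * h i k + h l k * h i j)
      + (h l i * \<nu> j k + h l j * \<nu> i k + h i j * \<nu> l k
          + h j k * \<nu> i l + h l k * \<nu> i j + h i k * \<nu> j l)
      + (es * p * f2 - 1 / 2 * es * Lbv * pm1)
          * (C l i j * m k + C i j k * m l + C j l k * m i + C l i k * m j)
      - Lbv * (M i j * Cb l k + M j l * Cb i k + M i l * Cb j k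
          + M l k * Cb i j + M j k * Cb i l + M i k * Cb j l)
      + Lbv * es\<^sup>2 * s0 * p\<^sup>2 * (Cb i j * Cb l k + Cb l j * Cb i k + Cb i l * Cb j k)
      + 1 / 2 * Lbv * (6 * K5 + p022) * m l * m i * m j * m k
      - Lbv * p02 / (2 * Lv) * (nn i j * m k * m l + nn l k * m i * m j)
      + 1 / 2 * p02 * (nd i j * m k * m l + nd l k * m i * m j)"
    unfolding coeff
    unfolding A_val m_val Cb_val f2_val Tb T h C
    unfolding Lv Lbv bt
    by (rule bc.T_tensor_Fb[OF z A_nz den_nz' K1_val K2_val K3_val K4_val K5_val
        nn_val nd_val M_val \<nu>_val])
qed

end
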